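(* Concurring Dirac structures form a Dirac pair. That is, if $L$ and $R$ are Dirac structures on a smooth manifold $M$ which concur, i.e. whose cotangent product $L\circledast R$ is itself a Dirac structure, then $(L,R)$ is a Dirac pair.
   Context: Let $\mathbb{T}M=TM\oplus T^*M$ with the pairing $\langle u+\xi,v+\eta\rangle=\iota_v\xi+\iota_u\eta$, the Dorfman bracket $[u+\xi,v+\eta]=[u,v]+\mathscr{L}_u\eta-\iota_v\mathrm{d}\xi$ on sections, and the projections $\mathrm{pr}_T:\mathbb{T}M\to TM$, $\mathrm{pr}_{T^*}:\mathbb{T}M\to T^*M$. A Lagrangian family is a subset $L\subset\mathbb{T}M$ meeting every fibre in a linear subspace $L_x$ with $L_x=L_x^\perp$ (no continuity in $x$ is assumed); it is smooth if it is a vector subbundle of $\mathbb{T}M$. A Dirac structure is a smooth Lagrangian family $L$ whose space of sections $\Gamma(L)$ is closed under the Dorfman bracket. The cotangent product of two Lagrangian families $L,R$ is the Lagrangian family $L\circledast R=\{a+\mathrm{pr}_T(b)\mid (a,b)\in L\times R \text{ in the same fibre},\ \mathrm{pr}_{T^*}(a-b)=0\}$. Two Dirac structures $L$ and $R$ concur if $L\circledast R$ is a Dirac structure. Dirac pairs: for Dirac structures $L,R$ put $$L\diamondsuit_T R=\{(u,v)\in TM\oplus TM\mid \exists\,\xi\in T^*M,\ u+\xi\in L,\ v+\xi\in R\},$$ $$L\diamondsuit_{T^*}R=\{(\xi,\eta)\in T^*M\oplus T^*M\mid\exists\, w\in TM,\ w+\xi\in L,\ w+\eta\in R\}.$$ Let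 $\mathscr{P}(L,R)$ be the set of all $7$-tuples $(u_L,u_R,v_L,v_R,\zeta_L,\zeta_{LR},\zeta_R)$ with $u_L,u_R,v_L,v_R\in\mathfrak{X}(M)$ and $\zeta_L,\zeta_{LR},\zeta_R\in\Omega^1(M)$ such that $(u_L,u_R)$ and $(v_L,v_R)$ take values in $L\diamondsuit_T R$, while $(\zeta_{LR},\zeta_R)$ and $(\zeta_L,\zeta_{LR})$ take values in $L\diamondsuit_{T^*}R$. The torsion of $(L,R)$ is the function $\mathscr{P}(L,R)\to C^\infty(M)$ sending such a tuple to $$\langle[u_L,v_L],\zeta_L\rangle-\langle[u_L,v_R]+[u_R,v_L],\zeta_{LR}\rangle+\langle[u_R,v_R],\zeta_R\rangle.$$ Two Dirac structures $(L,R)$ form a Dirac pair if their torsion vanishes identically. *)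

theory Defs
  imports "HOL-Analysis.Analysis" "HOL-Library.Function_Algebras"
begin

instantiation "fun" :: (type, real_vector) real_vector
begin

definition scaleR_fun :: "real \<Rightarrow> ('a \<Rightarrow> 'b) \<Rightarrow> 'a \<Rightarrow> 'b"
  where "scaleR_fun r f = (\<lambda>x. r *\<^sub>R f x)"

instance
  by standard (auto simp: scaleR_fun_def fun_eq_iff scaleR_add_right scaleR_add_left)

end

text \<open>
  These notions are meant for open \<^term>\<open>S\<close> and finite-dimensional \<^typ>\<open>'e\<close>; then
  \<open>Ck_on k S f\<close> says that \<^term>\<open>f\<close> is \<open>k\<close> times continuously differentiable on \<^term>\<open>S\<close>.
\<close>

primrec Ck_on :: "nat \<Rightarrow> 'e set \<Rightarrow> ('e::real_normed_vector \<Rightarrow> 'f::real_normed_vector) \<Rightarrow> bool"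
  where
    "Ck_on 0 S f \<longleftrightarrow> continuous_on S f"
  | "Ck_on (Suc k) S f \<longleftrightarrow>
       (\<forall>x\<in>S. f differentiable (at x)) \<and>
       (\<forall>w. Ck_on k S (\<lambda>x. frechet_derivative f (at x) w))"

definition smooth_on :: "'e set \<Rightarrow> ('e::real_normed_vector \<Rightarrow> 'f::real_normed_vector) \<Rightarrow> bool"
  where "smooth_on S f \<longleftrightarrow> (\<forall>k. Ck_on k S f)"

text \<open>
  A chart is a pair of its domain and its coordinate map; the values of the coordinate map
  outside the domain are irrelevant. The underlying space of the manifold is the whole type
  \<^typ>\<open>'a\<close> with its class topology. The model space is a finite-dimensional real inner
  product space rather than a type of class \<^class>\<open>euclidean_space\<close>, as the latter would
  exclude dimension zero.
\<close>

type_synonym ('a, 'e) chart = "'a set \<times> ('a \<Rightarrow> 'e)"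

abbreviation cdom :: "('a, 'e) chart \<Rightarrow> 'a set" where "cdom \<equiv> fst"
abbreviation cmap :: "('a, 'e) chart \<Rightarrow> 'a \<Rightarrow> 'e" where "cmap \<equiv> snd"

definition cinv :: "('a, 'e) chart \<Rightarrow> 'e \<Rightarrow> 'a"
  where "cinv c = inv_into (cdom c) (cmap c)"

definition is_chart :: "('a::topological_space, 'e::topological_space) chart \<Rightarrow> bool"
  where "is_chart c \<longleftrightarrow>
    open (cdom c) \<and> open (cmap c ` cdom c) \<and>
    homeomorphism (cdom c) (cmap c ` cdom c) (cmap c) (cinv c)"

definition transition :: "('a, 'e) chart \<Rightarrow> ('a, 'e) chart \<Rightarrow> 'e \<Rightarrow> 'e"
  where "transition c c' = cmap c' \<circ> cinv c"

definition smooth_manifold ::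
    "('a::{t2_space,second_countable_topology}, 'e::real_inner) chart set \<Rightarrow> bool"
  where "smooth_manifold A \<longleftrightarrow>
    (\<exists>B :: 'e set. finite B \<and> span B = UNIV) \<and>
    (\<forall>c\<in>A. is_chart c) \<and>
    (\<Union>c\<in>A. cdom c) = UNIV \<and>
    (\<forall>c\<in>A. \<forall>c'\<in>A. smooth_on (cmap c ` (cdom c \<inter> cdom c')) (transition c c'))"

text \<open>
  A (co)tangent vector at \<open>x\<close> is the family of its components in all charts of the atlas around
  \<open>x\<close>, subject to the usual transformation law. Components with respect to anything else are
  set to zero, so that (co)tangent vectors are determined by their components and form a
  linear subspace of the function space.
\<close>

type_synonym ('a, 'e) tvec = "('a, 'e) chart \<Rightarrow> 'e"
type_synonym ('a, 'e) covec = "('a, 'e) chart \<Rightarrow> 'e \<Rightarrow>\<^sub>L real"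

definition charts_at :: "('a, 'e) chart set \<Rightarrow> 'a \<Rightarrow> ('a, 'e) chart set"
  where "charts_at A x = {c \<in> A. x \<in> cdom c}"

definition dtrans ::
    "('a, 'e::real_normed_vector) chart \<Rightarrow> ('a, 'e) chart \<Rightarrow> 'a \<Rightarrow> 'e \<Rightarrow> 'e"
  where "dtrans c c' x = frechet_derivative (transition c c') (at (cmap c x))"

definition tangent_space ::
    "('a, 'e::real_normed_vector) chart set \<Rightarrow> 'a \<Rightarrow> ('a, 'e) tvec set"
  where "tangent_space A x =
    {v. (\<forall>c\<in>charts_at A x. \<forall>c'\<in>charts_at A x. v c' = dtrans c c' x (v c)) \<and>
        (\<forall>c. c \<notin> charts_at A x \<longrightarrow> v c = 0)}"

definition cotangent_space ::
    "('a, 'e::real_normed_vector) chart set \<Rightarrow> 'a \<Rightarrow> ('a, 'e) covec set"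
  where "cotangent_space A x =
    {\<xi>. (\<forall>c\<in>charts_at A x. \<forall>c'\<in>charts_at A x. \<forall>w.
           blinfun_apply (\<xi> c) w = blinfun_apply (\<xi> c') (dtrans c c' x w)) \<and>
        (\<forall>c. c \<notin> charts_at A x \<longrightarrow> \<xi> c = 0)}"

text \<open>The evaluation of a covector on a vector does not depend on the chart that is picked.\<close>

definition ev ::
    "('a, 'e::real_normed_vector) chart set \<Rightarrow> 'a \<Rightarrow> ('a, 'e) tvec \<Rightarrow> ('a, 'e) covec \<Rightarrow> real"
  where "ev A x v \<xi> = (let c = (SOME c. c \<in> charts_at A x) in blinfun_apply (\<xi> c) (v c))"

definition rep :: "('a, 'e) chart \<Rightarrow> ('a \<Rightarrow> ('a, 'e) chart \<Rightarrow> 'f) \<Rightarrow> 'e \<Rightarrow> 'f"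
  where "rep c s y = s (cinv c y) c"

definition drep ::
    "('a, 'e) chart \<Rightarrow> ('a \<Rightarrow> ('a, 'e::real_normed_vector) chart \<Rightarrow> 'f::real_normed_vector)
      \<Rightarrow> 'a \<Rightarrow> 'e \<Rightarrow> 'f"
  where "drep c s x = frechet_derivative (rep c s) (at (cmap c x))"

definition vector_field_on ::
    "('a, 'e::real_normed_vector) chart set \<Rightarrow> 'a set \<Rightarrow> ('a \<Rightarrow> ('a, 'e) tvec) \<Rightarrow> bool"
  where "vector_field_on A U u \<longleftrightarrow>
    (\<forall>x\<in>U. u x \<in> tangent_space A x) \<and>
    (\<forall>c\<in>A. smooth_on (cmap c ` (cdom c \<inter> U)) (rep c u))"

definition one_form_on ::
    "('a, 'e::real_normed_vector) chart set \<Rightarrow> 'a set \<Rightarrow> ('a \<Rightarrow> ('a, 'e) covec) \<Rightarrow> bool"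
  where "one_form_on A U \<xi> \<longleftrightarrow>
    (\<forall>x\<in>U. \<xi> x \<in> cotangent_space A x) \<and>
    (\<forall>c\<in>A. smooth_on (cmap c ` (cdom c \<inter> U)) (rep c \<xi>))"

abbreviation vector_field where "vector_field A \<equiv> vector_field_on A UNIV"
abbreviation one_form where "one_form A \<equiv> one_form_on A UNIV"

definition lie_bracket ::
    "('a, 'e::real_normed_vector) chart set \<Rightarrow> ('a \<Rightarrow> ('a, 'e) tvec) \<Rightarrow> ('a \<Rightarrow> ('a, 'e) tvec)
      \<Rightarrow> 'a \<Rightarrow> ('a, 'e) tvec"
  where "lie_bracket A u v x = (\<lambda>c.
    if c \<in> charts_at A x then drep c v x (u x c) - drep c u x (v x c) else 0)"

text \<open>In coordinates, \<open>(L\<^sub>u \<eta>)(w) = (D\<^sub>u \<eta>)(w) + \<eta>(D\<^sub>w u)\<close>.\<close>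

definition lie_derivative ::
    "('a, 'e::real_normed_vector) chart set \<Rightarrow> ('a \<Rightarrow> ('a, 'e) tvec) \<Rightarrow> ('a \<Rightarrow> ('a, 'e) covec)
      \<Rightarrow> 'a \<Rightarrow> ('a, 'e) covec"
  where "lie_derivative A u \<eta> x = (\<lambda>c.
    if c \<in> charts_at A x
    then Blinfun (\<lambda>w. blinfun_apply (drep c \<eta> x (u x c)) w +
                      blinfun_apply (\<eta> x c) (drep c u x w))
    else 0)"

text \<open>
  In coordinates, \<open>(d\<xi>)(v, w) = (D\<^sub>v \<xi>)(w) - (D\<^sub>w \<xi>)(v)\<close>. A two-form at a point is given by
  its components, which are bilinear forms on the model space.
\<close>

definition ext_derivative ::
    "('a, 'e::real_normed_vector) chart set \<Rightarrow> ('a \<Rightarrow> ('a, 'e) covec)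
      \<Rightarrow> 'a \<Rightarrow> ('a, 'e) chart \<Rightarrow> 'e \<Rightarrow> 'e \<Rightarrow> real"
  where "ext_derivative A \<xi> x = (\<lambda>c v w.
    if c \<in> charts_at A x
    then blinfun_apply (drep c \<xi> x v) w - blinfun_apply (drep c \<xi> x w) v
    else 0)"

definition interior ::
    "('a, 'e::real_normed_vector) tvec \<Rightarrow> (('a, 'e) chart \<Rightarrow> 'e \<Rightarrow> 'e \<Rightarrow> real) \<Rightarrow> ('a, 'e) covec"
  where "interior v \<omega> = (\<lambda>c. Blinfun (\<omega> c (v c)))"

text \<open>An element \<open>u + \<xi>\<close> of a fibre of \<open>TM \<oplus> T\<^sup>*M\<close> is written as the pair \<open>(u, \<xi>)\<close>.\<close>

type_synonym ('a, 'e) gvec = "('a, 'e) tvec \<times> ('a, 'e) covec"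

definition gen_space ::
    "('a, 'e::real_normed_vector) chart set \<Rightarrow> 'a \<Rightarrow> ('a, 'e) gvec set"
  where "gen_space A x = tangent_space A x \<times> cotangent_space A x"

definition pairing ::
    "('a, 'e::real_normed_vector) chart set \<Rightarrow> 'a \<Rightarrow> ('a, 'e) gvec \<Rightarrow> ('a, 'e) gvec \<Rightarrow> real"
  where "pairing A x a b = ev A x (fst b) (snd a) + ev A x (fst a) (snd b)"

definition gen_section_on ::
    "('a, 'e::real_normed_vector) chart set \<Rightarrow> 'a set \<Rightarrow> ('a \<Rightarrow> ('a, 'e) gvec) \<Rightarrow> bool"
  where "gen_section_on A U a \<longleftrightarrow>
    vector_field_on A U (\<lambda>x. fst (a x)) \<and> one_form_on A U (\<lambda>x. snd (a x))"

definition dorfman ::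
    "('a, 'e::real_normed_vector) chart set \<Rightarrow> ('a \<Rightarrow> ('a, 'e) gvec) \<Rightarrow> ('a \<Rightarrow> ('a, 'e) gvec)
      \<Rightarrow> 'a \<Rightarrow> ('a, 'e) gvec"
  where "dorfman A a b x =
    (let u = (\<lambda>x. fst (a x)); \<xi> = (\<lambda>x. snd (a x)); v = (\<lambda>x. fst (b x)); \<eta> = (\<lambda>x. snd (b x))
     in (lie_bracket A u v x,
         lie_derivative A u \<eta> x - interior (v x) (ext_derivative A \<xi> x)))"

text \<open>A family is given by its fibres \<open>L x\<close>.\<close>

type_synonym ('a, 'e) family = "'a \<Rightarrow> ('a, 'e) gvec set"

definition perp ::
    "('a, 'e::real_normed_vector) chart set \<Rightarrow> 'a \<Rightarrow> ('a, 'e) gvec set \<Rightarrow> ('a, 'e) gvec set"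
  where "perp A x S = {a \<in> gen_space A x. \<forall>b\<in>S. pairing A x a b = 0}"

definition lagrangian_family ::
    "('a, 'e::real_normed_vector) chart set \<Rightarrow> ('a, 'e) family \<Rightarrow> bool"
  where "lagrangian_family A L \<longleftrightarrow>
    (\<forall>x. L x \<subseteq> gen_space A x \<and> subspace (L x) \<and> L x = perp A x (L x))"

text \<open>A vector subbundle is a family of subspaces that admits smooth local frames.\<close>

definition local_frame ::
    "('a, 'e::real_normed_vector) chart set \<Rightarrow> ('a, 'e) family \<Rightarrow> 'a set \<Rightarrow> nat
      \<Rightarrow> (nat \<Rightarrow> 'a \<Rightarrow> ('a, 'e) gvec) \<Rightarrow> bool"
  where "local_frame A L U k e \<longleftrightarrow>
    (\<forall>i<k. gen_section_on A U (e i)) \<and>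
    (\<forall>x\<in>U. inj_on (\<lambda>i. e i x) {..<k} \<and>
            independent ((\<lambda>i. e i x) ` {..<k}) \<and>
            span ((\<lambda>i. e i x) ` {..<k}) = L x)"

definition smooth_family ::
    "('a::topological_space, 'e::real_normed_vector) chart set \<Rightarrow> ('a, 'e) family \<Rightarrow> bool"
  where "smooth_family A L \<longleftrightarrow>
    (\<forall>x. \<exists>U k e. open U \<and> x \<in> U \<and> local_frame A L U k e)"

definition sections ::
    "('a, 'e::real_normed_vector) chart set \<Rightarrow> ('a, 'e) family \<Rightarrow> ('a \<Rightarrow> ('a, 'e) gvec) set"
  where "sections A L = {a. gen_section_on A UNIV a \<and> (\<forall>x. a x \<in> L x)}"

definition dirac_structure ::
    "('a::topological_space, 'e::real_normed_vector) chart set \<Rightarrow> ('a, 'e) family \<Rightarrow> bool"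
  where "dirac_structure A L \<longleftrightarrow>
    lagrangian_family A L \<and> smooth_family A L \<and>
    (\<forall>a\<in>sections A L. \<forall>b\<in>sections A L. dorfman A a b \<in> sections A L)"

definition cotangent_product ::
    "('a, 'e::real_normed_vector) family \<Rightarrow> ('a, 'e) family \<Rightarrow> ('a, 'e) family"
  where "cotangent_product L R x = {a + (fst b, 0) | a b. a \<in> L x \<and> b \<in> R x \<and> snd (a - b) = 0}"

definition concur ::
    "('a::topological_space, 'e::real_normed_vector) chart set \<Rightarrow> ('a, 'e) family
      \<Rightarrow> ('a, 'e) family \<Rightarrow> bool"
  where "concur A L R \<longleftrightarrow>
    dirac_structure A L \<and> dirac_structure A R \<and> dirac_structure A (cotangent_product L R)"

definition diamond_T ::
    "('a, 'e::real_normed_vector) chart set \<Rightarrow> ('a, 'e) family \<Rightarrow> ('a, 'e) family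
      \<Rightarrow> 'a \<Rightarrow> (('a, 'e) tvec \<times> ('a, 'e) tvec) set"
  where "diamond_T A L R x =
    {(u, v). u \<in> tangent_space A x \<and> v \<in> tangent_space A x \<and>
             (\<exists>\<xi>\<in>cotangent_space A x. (u, \<xi>) \<in> L x \<and> (v, \<xi>) \<in> R x)}"

definition diamond_coT ::
    "('a, 'e::real_normed_vector) chart set \<Rightarrow> ('a, 'e) family \<Rightarrow> ('a, 'e) family
      \<Rightarrow> 'a \<Rightarrow> (('a, 'e) covec \<times> ('a, 'e) covec) set"
  where "diamond_coT A L R x =
    {(\<xi>, \<eta>). \<xi> \<in> cotangent_space A x \<and> \<eta> \<in> cotangent_space A x \<and>
             (\<exists>w\<in>tangent_space A x. (w, \<xi>) \<in> L x \<and> (w, \<eta>) \<in> R x)}"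

type_synonym ('a, 'e) torsion_arg =
  "('a \<Rightarrow> ('a, 'e) tvec) \<times> ('a \<Rightarrow> ('a, 'e) tvec) \<times> ('a \<Rightarrow> ('a, 'e) tvec) \<times> ('a \<Rightarrow> ('a, 'e) tvec) \<times>
   ('a \<Rightarrow> ('a, 'e) covec) \<times> ('a \<Rightarrow> ('a, 'e) covec) \<times> ('a \<Rightarrow> ('a, 'e) covec)"

definition torsion_domain ::
    "('a, 'e::real_normed_vector) chart set \<Rightarrow> ('a, 'e) family \<Rightarrow> ('a, 'e) family
      \<Rightarrow> ('a, 'e) torsion_arg set"
  where "torsion_domain A L R =
    {(uL, uR, vL, vR, \<zeta>L, \<zeta>LR, \<zeta>R).
       vector_field A uL \<and> vector_field A uR \<and> vector_field A vL \<and> vector_field A vR \<and>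
       one_form A \<zeta>L \<and> one_form A \<zeta>LR \<and> one_form A \<zeta>R \<and>
       (\<forall>x. (uL x, uR x) \<in> diamond_T A L R x \<and>
            (vL x, vR x) \<in> diamond_T A L R x \<and>
            (\<zeta>LR x, \<zeta>R x) \<in> diamond_coT A L R x \<and>
            (\<zeta>L x, \<zeta>LR x) \<in> diamond_coT A L R x)}"

definition torsion ::
    "('a, 'e::real_normed_vector) chart set \<Rightarrow> ('a, 'e) torsion_arg \<Rightarrow> 'a \<Rightarrow> real"
  where "torsion A = (\<lambda>(uL, uR, vL, vR, \<zeta>L, \<zeta>LR, \<zeta>R) x.
    ev A x (lie_bracket A uL vL x) (\<zeta>L x)
    - ev A x (lie_bracket A uL vR x + lie_bracket A uR vL x) (\<zeta>LR x)
    + ev A x (lie_bracket A uR vR x) (\<zeta>R x))"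

definition dirac_pair ::
    "('a::topological_space, 'e::real_normed_vector) chart set \<Rightarrow> ('a, 'e) family
      \<Rightarrow> ('a, 'e) family \<Rightarrow> bool"
  where "dirac_pair A L R \<longleftrightarrow>
    dirac_structure A L \<and> dirac_structure A R \<and>
    (\<forall>p\<in>torsion_domain A L R. \<forall>x. torsion A p x = 0)"

end

theory Submission
  imports Defs
begin

text \<open>
  Suppose first that a pair \<open>(u\<^sub>L, u\<^sub>R)\<close> comes with one smooth form \<open>\<xi>\<close> such that \<open>u\<^sub>L + \<xi>\<close> is a
  section of \<open>L\<close> and \<open>u\<^sub>R + \<xi>\<close> one of \<open>R\<close>, and \<open>(v\<^sub>L, v\<^sub>R)\<close> likewise with \<open>\<eta>\<close>. Then
  \<open>u\<^sub>L + u\<^sub>R + \<xi>\<close> and \<open>v\<^sub>L + v\<^sub>R + \<eta>\<close> are sections of the cotangent product. The Dorfman bracket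
  of two sections of a Dirac structure is orthogonal to it. Use this at one point for the two
  elements of \<open>L\<close>, the two of \<open>R\<close> and the one of the cotangent product that are built from
  \<open>\<zeta>\<^sub>L\<close>, \<open>\<zeta>\<^sub>L\<^sub>R\<close>, \<open>\<zeta>\<^sub>R\<close> and their companion vectors. As both entries of the bracket
  are additive in the vector fields for fixed \<open>\<xi>\<close> and \<open>\<eta>\<close>, these five equations add up to the
  vanishing of the torsion (\<open>torsion_in_zero_of_common_forms\<close>).

  The difficulty is that the definition of the torsion provides \<open>\<xi>\<close> only pointwise. It is determined
  up to the intersection of \<open>L\<close>, \<open>R\<close> and the cotangent bundle, whose rank may jump, so that
  there may be no smooth choice near a given point. But in local frames \<open>\<xi>\<close> solves a linear system with
  smooth coefficients, and a pointwise solvable system of this kind has a smooth solution on some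
  nonempty open part of every nonempty open set (\<open>smooth_linear_system\<close>,
  \<open>ex_smooth_common_form\<close>). A bump function makes the local sections global without changing
  the brackets at the given point. Hence the torsion vanishes on a dense set, and it is
  continuous (\<open>torsion_in_zero\<close>). Brackets and torsion are taken in one fixed chart: there
  the torsion is visibly continuous, and a pairing of elements of a Lagrangian family can be read off
  in any chart.
\<close>

section \<open>Calculus of smooth maps\<close>

lemma Ck_on_imp_continuous_on: "Ck_on k S f \<Longrightarrow> continuous_on S f"
  by (cases k)
    (auto intro!: continuous_at_imp_continuous_on differentiable_imp_continuous_within)

lemma Ck_on_SucD: "Ck_on (Suc k) S f \<Longrightarrow> Ck_on k S f"
proof (induction k arbitrary: f)
  case 0
  then show ?case using Ck_on_imp_continuous_on[of "Suc 0" S f] by simp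
qed auto

lemma Ck_on_subset: "Ck_on k S f \<Longrightarrow> T \<subseteq> S \<Longrightarrow> Ck_on k T f"
  by (induction k arbitrary: f) (auto intro: continuous_on_subset)

lemma Ck_on_cong:
  assumes "open S" "\<And>x. x \<in> S \<Longrightarrow> f x = g x" "Ck_on k S f"
  shows "Ck_on k S g"
  using assms(2,3)
proof (induction k arbitrary: f g)
  case 0
  then show ?case by (simp cong: continuous_on_cong)
next
  case (Suc k)
  have D: "(g has_derivative frechet_derivative f (at x)) (at x)" if "x \<in> S" for x
  proof (rule has_derivative_transform_within_open[OF _ \<open>open S\<close> that])
    show "(f has_derivative frechet_derivative f (at x)) (at x)"
      using Suc.prems(2) that by (simp add: frechet_derivative_works)
  qed (use Suc.prems(1) in auto)
  have eq: "frechet_derivative f (at x) w = frechet_derivative g (at x) w" if "x \<in> S" for x w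
    using frechet_derivative_at[OF D[OF that]] by simp
  have "Ck_on k S (\<lambda>x. frechet_derivative g (at x) w)" for w
    by (rule Suc.IH[of "\<lambda>x. frechet_derivative f (at x) w"]) (use eq Suc.prems(2) in auto)
  moreover have "\<forall>x\<in>S. g differentiable (at x)"
    using D differentiable_def by blast
  ultimately show ?case by simp
qed

lemma Ck_on_SucI:
  assumes "open S" "\<And>x. x \<in> S \<Longrightarrow> (f has_derivative f' x) (at x)"
    and "\<And>w. Ck_on k S (\<lambda>x. f' x w)"
  shows "Ck_on (Suc k) S f"
proof -
  have "Ck_on k S (\<lambda>x. frechet_derivative f (at x) w)" for w
    by (rule Ck_on_cong[OF assms(1) _ assms(3)[of w]])
      (use frechet_derivative_at[OF assms(2)] in auto)
  moreover have "\<forall>x\<in>S. f differentiable (at x)"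
    using assms(2) differentiableI by blast
  ultimately show ?thesis by simp
qed

lemma Ck_on_SucE:
  assumes "Ck_on (Suc k) S f"
  shows "\<And>x. x \<in> S \<Longrightarrow> (f has_derivative frechet_derivative f (at x)) (at x)"
    and "\<And>w. Ck_on k S (\<lambda>x. frechet_derivative f (at x) w)"
  using assms by (auto simp: frechet_derivative_works)

lemma Ck_on_const: "open S \<Longrightarrow> Ck_on k S (\<lambda>x. a)"
proof (induction k arbitrary: a)
  case (Suc k)
  show ?case
    by (rule Ck_on_SucI[where f' = "\<lambda>x w. 0"]) (use Suc in auto)
qed simp

lemma Ck_on_add:
  assumes "open S" "Ck_on k S f" "Ck_on k S g"
  shows "Ck_on k S (\<lambda>x. f x + g x)"
  using assms(2,3)
proof (induction k arbitrary: f g)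
  case (Suc k)
  note Df = Ck_on_SucE[OF Suc.prems(1)] and Dg = Ck_on_SucE[OF Suc.prems(2)]
  show ?case
    by (rule Ck_on_SucI[OF assms(1) has_derivative_add[OF Df(1) Dg(1)]])
      (auto intro!: Suc.IH Df(2) Dg(2))
qed (auto intro: continuous_intros)

lemma Ck_on_bounded_linear:
  assumes "bounded_linear h" "open S" "Ck_on k S f"
  shows "Ck_on k S (\<lambda>x. h (f x))"
  using assms(3)
proof (induction k arbitrary: f)
  case 0
  then show ?case
    using bounded_linear.continuous_on[OF assms(1)] by auto
next
  case (Suc k)
  note Df = Ck_on_SucE[OF Suc.prems]
  show ?case
    by (rule Ck_on_SucI[OF assms(2) bounded_linear.has_derivative[OF assms(1) Df(1)]])
      (auto intro!: Suc.IH Df(2))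
qed

lemma Ck_on_bounded_bilinear:
  assumes "bounded_bilinear p" "open S" "Ck_on k S f" "Ck_on k S g"
  shows "Ck_on k S (\<lambda>x. p (f x) (g x))"
  using assms(3,4)
proof (induction k arbitrary: f g)
  case 0
  then show ?case
    using bounded_bilinear.continuous_on[OF assms(1)] by auto
next
  case (Suc k)
  note Df = Ck_on_SucE[OF Suc.prems(1)] and Dg = Ck_on_SucE[OF Suc.prems(2)]
  show ?case
    by (rule Ck_on_SucI[OF assms(2) bounded_bilinear.FDERIV[OF assms(1) Df(1) Dg(1)]])
      (auto intro!: Ck_on_add[OF assms(2)] Suc.IH Df(2) Dg(2)
        Ck_on_SucD[OF Suc.prems(1)] Ck_on_SucD[OF Suc.prems(2)])
qed

lemma Ck_on_inverse:
  fixes f :: "'e::real_normed_vector \<Rightarrow> real"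
  assumes "open S" "Ck_on k S f" "\<And>x. x \<in> S \<Longrightarrow> f x \<noteq> 0"
  shows "Ck_on k S (\<lambda>x. inverse (f x))"
  using assms(2)
proof (induction k)
  case 0
  then show ?case using assms(3) by (auto intro!: continuous_intros)
next
  case (Suc k)
  note Df = Ck_on_SucE[OF Suc.prems]
  have inv: "Ck_on k S (\<lambda>x. inverse (f x))"
    by (rule Suc.IH) (rule Ck_on_SucD[OF Suc.prems])
  show ?case
  proof (rule Ck_on_SucI[OF assms(1) Deriv.has_derivative_inverse[OF assms(3) Df(1)]])
    fix w
    show "Ck_on k S (\<lambda>x. - (inverse (f x) * frechet_derivative f (at x) w * inverse (f x)))"
      by (intro Ck_on_bounded_linear[OF bounded_linear_minus[OF bounded_linear_ident]]
          Ck_on_bounded_bilinear[OF bounded_bilinear_mult] assms(1) inv Df(2))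
  qed auto
qed

lemma Ck_on_Un:
  assumes "open S" "open T" "Ck_on k S f" "Ck_on k T f"
  shows "Ck_on k (S \<union> T) f"
  using assms(3,4)
  by (induction k arbitrary: f) (auto intro: continuous_on_open_Un[OF assms(1,2)])

text \<open>
  The model space has no preferred basis; what replaces one is a finite family with the
  reproducing property of an orthonormal basis, which expresses linear maps by finitely many values.
\<close>

definition parseval_frame :: "'e::real_inner set \<Rightarrow> bool"
  where "parseval_frame B \<longleftrightarrow> finite B \<and> (\<forall>w. (\<Sum>b\<in>B. (w \<bullet> b) *\<^sub>R b) = w)"

lemma linear_parseval_expansion:
  assumes "parseval_frame B" "linear h"
  shows "h w = (\<Sum>b\<in>B. (w \<bullet> b) *\<^sub>R h b)"
proof -
  have "h w = h (\<Sum>b\<in>B. (w \<bullet> b) *\<^sub>R b)" using assms(1) by (simp add: parseval_frame_def)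
  also have "\<dots> = (\<Sum>b\<in>B. (w \<bullet> b) *\<^sub>R h b)"
    by (simp add: linear_sum[OF assms(2)] linear_cmul[OF assms(2)])
  finally show ?thesis .
qed

lemma ex_parseval_frame:
  fixes B :: "'e::real_inner set"
  assumes "finite B" "span B = UNIV"
  shows "\<exists>C :: 'e set. parseval_frame C"
proof -
  obtain C :: "'e set" where C: "finite C" "span C = UNIV" "pairwise orthogonal C"
    using basis_orthogonal[OF assms(1)] assms(2) by metis
  define D where "D = (\<lambda>b. b /\<^sub>R norm b) ` (C - {0})"
  have inj: "inj_on (\<lambda>b. b /\<^sub>R norm b) (C - {0})"
  proof (rule inj_onI, rule ccontr)
    fix a b assume ab: "a \<in> C - {0}" "b \<in> C - {0}" "a /\<^sub>R norm a = b /\<^sub>R norm b" "a \<noteq> b"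
    have "(a /\<^sub>R norm a) \<bullet> (b /\<^sub>R norm b) = 0"
      using C(3) ab(1,2,4) by (simp add: pairwise_def orthogonal_def)
    then have "a /\<^sub>R norm a = 0" using ab(3) by simp
    then show False using ab(1) by simp
  qed
  have fin: "finite D" using C(1) by (simp add: D_def)
  have gen: "(\<Sum>b\<in>D. (w \<bullet> b) *\<^sub>R b) = w" if "w \<in> span C" for w
    using that
  proof (induction rule: span_induct_alt)
    case base
    then show ?case by simp
  next
    case (step c x y)
    have "(\<Sum>b\<in>D. (x \<bullet> b) *\<^sub>R b) = x"
    proof (cases "x = 0")
      case False
      have "(\<Sum>b\<in>D. (x \<bullet> b) *\<^sub>R b)
          = (\<Sum>b\<in>C-{0}. (x \<bullet> (b /\<^sub>R norm b)) *\<^sub>R (b /\<^sub>R norm b))"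
        unfolding D_def by (subst sum.reindex[OF inj]) simp
      also have "\<dots> = (\<Sum>b\<in>C-{0}. if b = x then x else 0)"
      proof (intro sum.cong refl)
        fix b assume b: "b \<in> C - {0}"
        have "x \<bullet> b = 0" if "b \<noteq> x"
          using C(3) step(1) b that by (simp add: pairwise_def orthogonal_def)
        moreover have "inverse (norm x) * (x \<bullet> x) * inverse (norm x) = 1"
          using False by (simp add: field_simps flip: power2_norm_eq_inner power2_eq_square)
        ultimately show "(x \<bullet> (b /\<^sub>R norm b)) *\<^sub>R (b /\<^sub>R norm b) = (if b = x then x else 0)"
          by (cases "b = x") (simp_all add: mult.commute mult.left_commute)
      qed
      also have "\<dots> = x" using C(1) step(1) False by (simp add: sum.delta)
      finally show ?thesis .
    qed simp
    moreover have "(\<Sum>b\<in>D. ((c *\<^sub>R x + y) \<bullet> b) *\<^sub>R b)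
        = c *\<^sub>R (\<Sum>b\<in>D. (x \<bullet> b) *\<^sub>R b) + (\<Sum>b\<in>D. (y \<bullet> b) *\<^sub>R b)"
      by (simp add: inner_add_left scaleR_add_left sum.distrib scaleR_sum_right)
    ultimately show ?case using step(2) by simp
  qed
  show ?thesis
    using fin gen C(2) by (auto simp: parseval_frame_def intro!: exI[of _ D])
qed

text \<open>
  The ball is a closed part of the image of a cube under the synthesis map of the frame, and that
  image is compact by induction on the frame.
\<close>

lemma compact_cball_if_parseval_frame:
  fixes B :: "'e::real_inner set"
  assumes "parseval_frame B"
  shows "compact (cball (a::'e) r)"
proof -
  have fin: "finite B" using assms by (simp add: parseval_frame_def)
  have cube: "compact {(\<Sum>b\<in>C. t b *\<^sub>R b) | t. \<forall>b\<in>C. \<bar>t b\<bar> \<le> s}" (is "compact (?Q C)")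
    if "finite C" for s :: real and C :: "'e set"
    using that
  proof (induction C)
    case empty
    then show ?case by simp
  next
    case (insert c C)
    have "?Q (insert c C) = (\<lambda>(x, y). x *\<^sub>R c + y) ` ({-s..s} \<times> ?Q C)" (is "_ = ?I")
    proof
      show "?Q (insert c C) \<subseteq> ?I"
      proof
        fix v assume "v \<in> ?Q (insert c C)"
        then obtain t where t: "v = (\<Sum>b\<in>insert c C. t b *\<^sub>R b)" "\<forall>b\<in>insert c C. \<bar>t b\<bar> \<le> s"
          by blast
        then have "v = t c *\<^sub>R c + (\<Sum>b\<in>C. t b *\<^sub>R b)" using insert by simp
        then show "v \<in> ?I" using t(2)
          by (auto intro!: image_eqI[of _ _ "(t c, \<Sum>b\<in>C. t b *\<^sub>R b)"] simp: abs_le_iff)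
      qed
      show "?I \<subseteq> ?Q (insert c C)"
      proof clarify
        fix x t assume x: "x \<in> {-s..s}" and t: "\<forall>b\<in>C. \<bar>t b\<bar> \<le> s"
        have "x *\<^sub>R c + (\<Sum>b\<in>C. t b *\<^sub>R b) = (\<Sum>b\<in>insert c C. (t(c := x)) b *\<^sub>R b)"
          using insert by (simp, intro sum.cong) auto
        moreover have "\<forall>b\<in>insert c C. \<bar>(t(c := x)) b\<bar> \<le> s" using x t by auto
        ultimately show "\<exists>t'. x *\<^sub>R c + (\<Sum>b\<in>C. t b *\<^sub>R b) = (\<Sum>b\<in>insert c C. t' b *\<^sub>R b)
            \<and> (\<forall>b\<in>insert c C. \<bar>t' b\<bar> \<le> s)" by blast
      qed
    qed
    moreover have "compact ?I"
      by (intro compact_continuous_image compact_Times insert.IH compact_Icc)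
        (auto intro!: continuous_intros simp: case_prod_beta)
    ultimately show ?case by simp
  qed
  define s where "s = Max (insert 0 (norm ` B)) * (norm a + r)"
  have "w \<in> {(\<Sum>b\<in>B. t b *\<^sub>R b) | t. \<forall>b\<in>B. \<bar>t b\<bar> \<le> s}" (is "w \<in> ?P") if "w \<in> cball a r" for w
  proof -
    have "norm w \<le> norm a + r"
      using that norm_triangle_sub[of w a] by (simp add: dist_norm norm_minus_commute)
    then have "\<bar>w \<bullet> b\<bar> \<le> s" if "b \<in> B" for b
      unfolding s_def mult.commute[of _ "norm a + r"]
      by (intro order.trans[OF Cauchy_Schwarz_ineq2] mult_mono)
        (use fin that order.trans[OF norm_ge_zero] in auto)
    moreover have "w = (\<Sum>b\<in>B. (w \<bullet> b) *\<^sub>R b)" using assms by (simp add: parseval_frame_def)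
    ultimately show ?thesis by blast
  qed
  then have "?P \<inter> cball a r = cball a r" by blast
  then show ?thesis
    using compact_Int_closed[OF cube[OF fin, of s] closed_cball[of a r]] by simp
qed

text \<open>
  Being of class \<open>C\<^sup>k\<close> controls derivatives in constant directions. A varying direction, here
  and in the chain rule, is therefore expanded in a frame.
\<close>

lemma Ck_on_derivative_along:
  fixes f :: "'e::real_inner \<Rightarrow> 'f::real_normed_vector"
  assumes "parseval_frame (B :: 'e set)" "open S" "Ck_on (Suc k) S f" "Ck_on k S u"
  shows "Ck_on k S (\<lambda>x. frechet_derivative f (at x) (u x))"
proof -
  note Df = Ck_on_SucE[OF assms(3)]
  have sums: "Ck_on k S (\<lambda>x. \<Sum>b\<in>C. (u x \<bullet> b) *\<^sub>R frechet_derivative f (at x) b)"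
    if "finite C" for C
    using that
  proof (induction C)
    case (insert c C)
    then show ?case
      by (simp add: Ck_on_add[OF assms(2)] Df(2) assms(2)
          Ck_on_bounded_bilinear[OF bounded_bilinear_scaleR]
          Ck_on_bounded_linear[OF bounded_linear_inner_left] assms(4))
  qed (simp add: Ck_on_const assms(2))
  show ?thesis
    by (rule Ck_on_cong[OF assms(2) _ sums[of B]])
      (use assms(1) linear_parseval_expansion[OF assms(1) has_derivative_linear[OF Df(1)]]
       in \<open>auto simp: parseval_frame_def\<close>)
qed

lemma Ck_on_compose:
  fixes f :: "'e::real_normed_vector \<Rightarrow> 'g::real_inner"
  assumes "parseval_frame (B :: 'g set)" "open S" "open T" "f ` S \<subseteq> T"
    and "Ck_on k S f" "Ck_on k T g"
  shows "Ck_on k S (\<lambda>x. g (f x))"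
  using assms(5,6)
proof (induction k arbitrary: g)
  case 0
  then show ?case using assms(4) continuous_on_compose2 by auto
next
  case (Suc k)
  note Df = Ck_on_SucE[OF Suc.prems(1)] and Dg = Ck_on_SucE[OF Suc.prems(2)]
  have fT: "f x \<in> T" if "x \<in> S" for x using that assms(4) by auto
  have sums: "Ck_on k S (\<lambda>x. \<Sum>b\<in>C.
      (frechet_derivative f (at x) w \<bullet> b) *\<^sub>R frechet_derivative g (at (f x)) b)"
    if "finite C" for C w
    using that
  proof (induction C)
    case (insert c C)
    then show ?case
      by (simp add: Ck_on_add[OF assms(2)] Df(2) assms(2)
          Ck_on_bounded_bilinear[OF bounded_bilinear_scaleR]
          Ck_on_bounded_linear[OF bounded_linear_inner_left]
          Suc.IH[OF Ck_on_SucD[OF Suc.prems(1)] Dg(2)])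
  qed (simp add: Ck_on_const assms(2))
  show ?case
  proof (rule Ck_on_SucI[OF assms(2)])
    fix x assume x: "x \<in> S"
    show "((\<lambda>x. g (f x)) has_derivative
        (\<lambda>w. frechet_derivative g (at (f x)) (frechet_derivative f (at x) w))) (at x)"
      by (rule has_derivative_compose[OF Df(1)[OF x] Dg(1)[OF fT[OF x]]])
  next
    fix w
    show "Ck_on k S (\<lambda>x. frechet_derivative g (at (f x)) (frechet_derivative f (at x) w))"
      by (rule Ck_on_cong[OF assms(2) _ sums[of B w]])
        (use assms(1) linear_parseval_expansion[OF assms(1) has_derivative_linear[OF Dg(1)[OF fT]]]
         in \<open>auto simp: parseval_frame_def\<close>)
  qed
qed

lemma smooth_on_imp_continuous_on: "smooth_on S f \<Longrightarrow> continuous_on S f"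
  unfolding smooth_on_def using Ck_on_imp_continuous_on by blast

lemma smooth_on_imp_has_derivative:
  "smooth_on S f \<Longrightarrow> x \<in> S \<Longrightarrow> (f has_derivative frechet_derivative f (at x)) (at x)"
  unfolding smooth_on_def using Ck_on_SucE(1) by blast

lemma smooth_on_subset: "smooth_on S f \<Longrightarrow> T \<subseteq> S \<Longrightarrow> smooth_on T f"
  unfolding smooth_on_def using Ck_on_subset by blast

lemma smooth_on_cong:
  "open S \<Longrightarrow> (\<And>x. x \<in> S \<Longrightarrow> f x = g x) \<Longrightarrow> smooth_on S f \<Longrightarrow> smooth_on S g"
  unfolding smooth_on_def using Ck_on_cong by blast

lemma smooth_on_const: "open S \<Longrightarrow> smooth_on S (\<lambda>x. a)"
  unfolding smooth_on_def using Ck_on_const by blast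

lemma smooth_on_bounded_linear_compose:
  "bounded_linear h \<Longrightarrow> open S \<Longrightarrow> smooth_on S f \<Longrightarrow> smooth_on S (\<lambda>x. h (f x))"
  unfolding smooth_on_def using Ck_on_bounded_linear by blast

lemma smooth_on_id: "open S \<Longrightarrow> smooth_on S (\<lambda>x. x)"
  unfolding smooth_on_def
proof
  fix k assume "open S"
  then show "Ck_on k S (\<lambda>x. x)"
    by (cases k) (auto intro!: Ck_on_SucI[where f' = "\<lambda>x w. w"] Ck_on_const)
qed

lemma smooth_on_add:
  "open S \<Longrightarrow> smooth_on S f \<Longrightarrow> smooth_on S g \<Longrightarrow> smooth_on S (\<lambda>x. f x + g x)"
  unfolding smooth_on_def using Ck_on_add by blast

lemma smooth_on_minus: "open S \<Longrightarrow> smooth_on S f \<Longrightarrow> smooth_on S (\<lambda>x. - f x)"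
  by (rule smooth_on_bounded_linear_compose[OF bounded_linear_minus[OF bounded_linear_ident]])

lemma smooth_on_diff:
  "open S \<Longrightarrow> smooth_on S f \<Longrightarrow> smooth_on S g \<Longrightarrow> smooth_on S (\<lambda>x. f x - g x)"
  using smooth_on_add[of S f "\<lambda>x. - g x"] smooth_on_minus[of S g] by simp

lemma smooth_on_sum:
  assumes "open S" "\<And>i. i \<in> I \<Longrightarrow> smooth_on S (f i)"
  shows "smooth_on S (\<lambda>x. \<Sum>i\<in>I. f i x)"
  using assms(2)
  by (induction I rule: infinite_finite_induct)
    (auto intro: smooth_on_const smooth_on_add assms(1))

lemma smooth_on_bounded_bilinear:
  "bounded_bilinear p \<Longrightarrow> open S \<Longrightarrow> smooth_on S f \<Longrightarrow> smooth_on S g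
    \<Longrightarrow> smooth_on S (\<lambda>x. p (f x) (g x))"
  unfolding smooth_on_def using Ck_on_bounded_bilinear by blast

lemmas smooth_on_mult = smooth_on_bounded_bilinear[OF bounded_bilinear_mult]
lemmas smooth_on_scaleR = smooth_on_bounded_bilinear[OF bounded_bilinear_scaleR]

lemma smooth_on_Pair:
  assumes "open S" "smooth_on S f" "smooth_on S g"
  shows "smooth_on S (\<lambda>y. (f y, g y))"
proof -
  have "smooth_on S (\<lambda>y. (f y, 0))" "smooth_on S (\<lambda>y. (0, g y))"
    using
      smooth_on_bounded_linear_compose[OF
        bounded_linear_Pair[OF bounded_linear_ident bounded_linear_zero] assms(1,2)]
      smooth_on_bounded_linear_compose[OF
        bounded_linear_Pair[OF bounded_linear_zero bounded_linear_ident] assms(1,3)]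
    by simp_all
  from smooth_on_add[OF assms(1) this] show ?thesis by simp
qed

lemma smooth_on_divide:
  fixes f g :: "'e::real_normed_vector \<Rightarrow> real"
  assumes "open S" "smooth_on S f" "smooth_on S g" "\<And>x. x \<in> S \<Longrightarrow> g x \<noteq> 0"
  shows "smooth_on S (\<lambda>x. f x / g x)"
proof -
  have "smooth_on S (\<lambda>x. inverse (g x))"
    using assms(3) Ck_on_inverse[OF assms(1) _ assms(4)] by (simp add: smooth_on_def)
  from smooth_on_mult[OF assms(1,2) this] show ?thesis by (simp add: divide_inverse)
qed

lemma smooth_on_derivative_along:
  fixes f :: "'e::real_inner \<Rightarrow> 'f::real_normed_vector"
  assumes "parseval_frame (B :: 'e set)" "open S" "smooth_on S f" "smooth_on S u"
  shows "smooth_on S (\<lambda>x. frechet_derivative f (at x) (u x))"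
  using Ck_on_derivative_along[OF assms(1,2)] assms(3,4) unfolding smooth_on_def by blast

lemma smooth_on_compose:
  fixes f :: "'e::real_normed_vector \<Rightarrow> 'g::real_inner"
  assumes "parseval_frame (B :: 'g set)" "open S" "open T" "f ` S \<subseteq> T"
    and "smooth_on S f" "smooth_on T g"
  shows "smooth_on S (\<lambda>x. g (f x))"
  using Ck_on_compose[OF assms(1-4)] assms(5,6) unfolding smooth_on_def by blast

lemma smooth_on_Un:
  "open S \<Longrightarrow> open T \<Longrightarrow> smooth_on S f \<Longrightarrow> smooth_on T f \<Longrightarrow> smooth_on (S \<union> T) f"
  by (simp add: smooth_on_def Ck_on_Un)

section \<open>Plateau functions\<close>

text \<open>
  The derivatives of \<open>exp (- 1/t)\<close>, extended by zero, are linear combinations of the members of this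
  family; treating all members at once makes smoothness a single induction.
\<close>

definition flat :: "nat \<Rightarrow> real \<Rightarrow> real"
  where "flat n t = (if t > 0 then inverse t ^ n * exp (- inverse t) else 0)"

lemma flat_tendsto_0: "(flat n \<longlongrightarrow> 0) (at 0)"
proof -
  have "((\<lambda>t. inverse t ^ n / exp (inverse t)) \<longlongrightarrow> 0) (at_right (0::real))"
    by (rule filterlim_compose[OF tendsto_power_div_exp_0 filterlim_inverse_at_top_right])
  then have "(flat n \<longlongrightarrow> 0) (at_right 0)"
    by (rule Lim_transform_eventually)
      (auto simp: eventually_at_filter flat_def exp_minus divide_inverse)
  moreover have "(flat n \<longlongrightarrow> 0) (at_left 0)"
    by (rule Lim_transform_eventually[OF tendsto_const])
      (auto simp: eventually_at_filter flat_def)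
  ultimately show ?thesis using filterlim_split_at by blast
qed

lemma flat_has_derivative:
  "(flat n has_real_derivative (flat (n + 2) t - real n * flat (n + 1) t)) (at t)"
proof -
  consider "t > 0" | "t < 0" | "t = 0" by linarith
  then show ?thesis
  proof cases
    case 1
    have "((\<lambda>t. inverse t ^ n * exp (- inverse t)) has_real_derivative
        (flat (n + 2) t - real n * flat (n + 1) t)) (at t)"
      using 1
      by (auto intro!: derivative_eq_intros simp: flat_def field_simps power2_eq_square)
        (cases n; simp add: field_simps power2_eq_square)
    then show ?thesis
      by (rule has_field_derivative_transform_within_open[of _ _ _ "{0<..}"])
        (use 1 in \<open>auto simp: flat_def\<close>)
  next
    case 2
    have "((\<lambda>t. 0) has_real_derivative (flat (n + 2) t - real n * flat (n + 1) t)) (at t)"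
      using 2 by (simp add: flat_def)
    then show ?thesis
      by (rule has_field_derivative_transform_within_open[of _ _ _ "{..<0}"])
        (use 2 in \<open>auto simp: flat_def\<close>)
  next
    case 3
    have "((\<lambda>h. (flat n (0 + h) - flat n 0) / h) \<longlongrightarrow> 0) (at 0)"
      by (rule Lim_transform_eventually[OF flat_tendsto_0[of "n + 1"]])
        (auto simp: flat_def eventually_at_filter divide_inverse)
    then show ?thesis using 3 by (simp add: DERIV_def flat_def)
  qed
qed

lemma smooth_on_flat: "smooth_on UNIV (flat n)"
  unfolding smooth_on_def
proof
  fix k
  show "Ck_on k UNIV (flat n)"
  proof (induction k arbitrary: n)
    case 0
    show ?case
      by (auto intro!: continuous_at_imp_continuous_on DERIV_isCont[OF flat_has_derivative])
  next
    case (Suc k)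
    show ?case
    proof (rule Ck_on_SucI)
      show "(flat n has_derivative (\<lambda>w. (flat (n + 2) t - real n * flat (n + 1) t) * w)) (at t)"
        for t
        using flat_has_derivative[of n t] by (simp add: has_field_derivative_def)
      have "Ck_on k UNIV (\<lambda>t. flat (n + 2) t * w + flat (n + 1) t * (- real n * w))" for w
        by (intro Ck_on_add Ck_on_bounded_bilinear[OF bounded_bilinear_mult] Suc.IH
            Ck_on_const open_UNIV)
      then show "Ck_on k UNIV (\<lambda>t. (flat (n + 2) t - real n * flat (n + 1) t) * w)" for w
        by (simp add: algebra_simps)
    qed simp
  qed
qed

lemma ex_smooth_plateau:
  fixes a :: "'e::real_inner"
  assumes "r > 0"
  shows "\<exists>\<psi> :: 'e \<Rightarrow> real. smooth_on UNIV \<psi> \<and> (\<forall>y. dist a y < r / 2 \<longrightarrow> \<psi> y = 1) \<and>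
    (\<forall>y. y \<notin> cball a r \<longrightarrow> \<psi> y = 0)"
proof -
  define f where "f = flat 0"
  \<comment> \<open>On the ball of radius \<open>r / 2\<close>, \<open>q\<close> is nonpositive and the inner \<open>f\<close> vanishes; outside the
    ball of radius \<open>r\<close>, \<open>q\<close> exceeds \<open>3 * r\<^sup>2 / 4\<close>, and the argument of the outer \<open>f\<close> is nonpositive.\<close>
  define d where "d = f (3 * r\<^sup>2 / 4)"
  define q where "q = (\<lambda>y. (y - a) \<bullet> (y - a) - r\<^sup>2 / 4)"
  define \<psi> where "\<psi> = (\<lambda>y. f (d - f (q y)) / f d)"
  have R: "parseval_frame {1::real}" by (simp add: parseval_frame_def)
  have f_smooth: "smooth_on UNIV f" by (simp add: f_def smooth_on_flat)
  have q_smooth: "smooth_on UNIV q"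
    unfolding q_def
    by (intro smooth_on_diff smooth_on_bounded_bilinear[OF bounded_bilinear_inner]
        smooth_on_const smooth_on_id open_UNIV)
  have f_pos: "f t > 0" if "t > 0" for t using that by (simp add: f_def flat_def)
  have f_zero: "f t = 0" if "t \<le> 0" for t using that by (simp add: f_def flat_def)
  have d: "d > 0" using f_pos assms by (simp add: d_def)
  have "smooth_on UNIV (\<lambda>y. d - f (q y))"
    by (intro smooth_on_diff smooth_on_const open_UNIV
        smooth_on_compose[OF R _ _ _ q_smooth f_smooth]) auto
  then have "smooth_on UNIV (\<lambda>y. f (d - f (q y)))"
    by (intro smooth_on_compose[OF R _ _ _ _ f_smooth]) auto
  then have "smooth_on UNIV \<psi>"
    unfolding \<psi>_def using f_pos[OF d]
    by (intro smooth_on_divide smooth_on_const open_UNIV) auto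
  moreover have "\<psi> y = 1" if "dist a y < r / 2" for y
  proof -
    have "(dist a y)\<^sup>2 \<le> (r / 2)\<^sup>2" using that by (intro power_mono) auto
    then have "q y \<le> 0"
      by (simp add: q_def dist_norm norm_minus_commute[of a y] power2_norm_eq_inner power_divide)
    then show ?thesis using f_zero f_pos[OF d] by (simp add: \<psi>_def)
  qed
  moreover have "\<psi> y = 0" if "y \<notin> cball a r" for y
  proof -
    have "r\<^sup>2 \<le> (dist a y)\<^sup>2" using that assms by (intro power_mono) auto
    then have "3 * r\<^sup>2 / 4 \<le> q y"
      by (simp add: q_def dist_norm norm_minus_commute[of a y] power2_norm_eq_inner)
    moreover have "3 * r\<^sup>2 / 4 > 0" using assms by simp
    ultimately have "inverse (q y) \<le> inverse (3 * r\<^sup>2 / 4)" "q y > 0"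
      using le_imp_inverse_le less_le_trans by blast+
    then have "d \<le> f (q y)"
      using assms by (simp add: d_def f_def flat_def)
    then show ?thesis using f_zero by (simp add: \<psi>_def)
  qed
  ultimately show ?thesis by blast
qed

section \<open>Linear systems with smooth coefficients\<close>

text \<open>
  Gaussian elimination on a shrinking domain, by induction on the equations. Either the new equation has
  no nonzero coefficient anywhere on the domain, and then solvability makes it trivial; or
  one of its coefficients is nonzero on a smaller nonempty open set, and there it serves as
  pivot. Nothing is assumed about the rank, and for this reason the solution exists only on a part of
  the domain.
\<close>

lemma smooth_linear_system:
  fixes P :: "'j \<Rightarrow> 'i \<Rightarrow> 'e::real_normed_vector \<Rightarrow> real"
  assumes "finite J" "finite I" "open V" "V \<noteq> {}"
    and "\<And>i j. j \<in> J \<Longrightarrow> i \<in> I \<Longrightarrow> smooth_on V (P j i)"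
    and "\<And>j. j \<in> J \<Longrightarrow> smooth_on V (g j)"
    and "\<And>y. y \<in> V \<Longrightarrow> \<exists>a. \<forall>j\<in>J. (\<Sum>i\<in>I. P j i y * a i) = g j y"
  shows "\<exists>W s. open W \<and> W \<noteq> {} \<and> W \<subseteq> V \<and> (\<forall>i\<in>I. smooth_on W (s i)) \<and>
    (\<forall>y\<in>W. \<forall>j\<in>J. (\<Sum>i\<in>I. P j i y * s i y) = g j y)"
  using assms(1,3-7)
proof (induction J arbitrary: V P g)
  case empty
  then show ?case by (intro exI[of _ V] exI[of _ "\<lambda>i y. 0"]) (auto intro: smooth_on_const)
next
  case (insert m J)
  note V = insert.prems(1,2)
  show ?case
  proof (cases "\<forall>y\<in>V. \<forall>i\<in>I. P m i y = 0")
    case True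
    have g: "g m y = 0" if "y \<in> V" for y
      using insert.prems(5)[OF that] True that by auto
    have "\<exists>a. \<forall>j\<in>J. (\<Sum>i\<in>I. P j i y * a i) = g j y" if "y \<in> V" for y
      using insert.prems(5)[OF that] by blast
    then have "\<exists>W s. open W \<and> W \<noteq> {} \<and> W \<subseteq> V \<and> (\<forall>i\<in>I. smooth_on W (s i)) \<and>
        (\<forall>y\<in>W. \<forall>j\<in>J. (\<Sum>i\<in>I. P j i y * s i y) = g j y)"
      by (intro insert.IH[OF V] insert.prems(3,4)) simp_all
    then obtain W s where "open W" "W \<noteq> {}" "W \<subseteq> V" "\<forall>i\<in>I. smooth_on W (s i)"
      and "\<forall>y\<in>W. \<forall>j\<in>J. (\<Sum>i\<in>I. P j i y * s i y) = g j y"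
      by (elim exE conjE)
    moreover from this(3) have "(\<Sum>i\<in>I. P m i y * s i y) = g m y" if "y \<in> W" for y
      using True g that by (simp add: subset_iff)
    ultimately have "open W \<and> W \<noteq> {} \<and> W \<subseteq> V \<and> (\<forall>i\<in>I. smooth_on W (s i)) \<and>
        (\<forall>y\<in>W. \<forall>j\<in>insert m J. (\<Sum>i\<in>I. P j i y * s i y) = g j y)"
      by simp
    then show ?thesis by (intro exI)
  next
    case False
    then obtain y0 p where y0: "y0 \<in> V" "p \<in> I" "P m p y0 \<noteq> 0" by blast
    have pivot_smooth: "smooth_on V (P m p)" using insert.prems(3) y0(2) by simp
    define V' where "V' = {y \<in> V. P m p y \<noteq> 0}"
    have "open (P m p -` (- {0}) \<inter> V)"
      using continuous_on_open_vimage[OF V(1)] smooth_on_imp_continuous_on[OF pivot_smooth]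
      by (metis open_Compl closed_singleton)
    then have V': "open V'" "V' \<noteq> {}" "V' \<subseteq> V"
      using y0 by (auto simp: V'_def vimage_def Int_def conj_commute)
    define c where "c = (\<lambda>j y. P j p y / P m p y)"
    have c_smooth: "smooth_on V' (c j)" if "j \<in> J" for j
      unfolding c_def
      by (intro smooth_on_divide V' smooth_on_subset[OF _ V'(3)] pivot_smooth insert.prems(3))
        (use that y0(2) in \<open>auto simp: V'_def\<close>)
    \<comment> \<open>Subtracting multiples of the pivot equation eliminates the pivot unknown.\<close>
    have "\<exists>W s. open W \<and> W \<noteq> {} \<and> W \<subseteq> V' \<and> (\<forall>i\<in>I. smooth_on W (s i)) \<and>
      (\<forall>y\<in>W. \<forall>j\<in>J. (\<Sum>i\<in>I. (P j i y - c j y * P m i y) * s i y) = g j y - c j y * g m y)"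
    proof (rule insert.IH)
      fix y assume "y \<in> V'"
      then obtain a where a: "\<forall>j\<in>insert m J. (\<Sum>i\<in>I. P j i y * a i) = g j y"
        using insert.prems(5) V'(3) by blast
      have "(\<Sum>i\<in>I. (P j i y - c j y * P m i y) * a i)
          = (\<Sum>i\<in>I. P j i y * a i) - c j y * (\<Sum>i\<in>I. P m i y * a i)" for j
        by (simp add: left_diff_distrib sum_subtractf sum_distrib_left mult.assoc)
      then show "\<exists>a. \<forall>j\<in>J. (\<Sum>i\<in>I. (P j i y - c j y * P m i y) * a i) = g j y - c j y * g m y"
        using a by (intro exI[of _ a]) auto
    qed (auto intro!: V' smooth_on_diff smooth_on_mult c_smooth
        smooth_on_subset[OF insert.prems(3) V'(3)] smooth_on_subset[OF insert.prems(4) V'(3)])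
    then obtain W s where W: "open W" "W \<noteq> {}" "W \<subseteq> V'" "\<forall>i\<in>I. smooth_on W (s i)"
      and s: "\<And>y j. y \<in> W \<Longrightarrow> j \<in> J \<Longrightarrow>
        (\<Sum>i\<in>I. (P j i y - c j y * P m i y) * s i y) = g j y - c j y * g m y"
      by blast
    have WV: "W \<subseteq> V" using W(3) V'(3) by simp
    \<comment> \<open>The remaining freedom in the pivot unknown is spent on the pivot equation.\<close>
    define d where "d = (\<lambda>y. (g m y - (\<Sum>i\<in>I. P m i y * s i y)) / P m p y)"
    define t where "t = s(p := \<lambda>y. s p y + d y)"
    have d_smooth: "smooth_on W d"
      unfolding d_def
      by (intro smooth_on_divide smooth_on_diff smooth_on_sum smooth_on_mult W
          smooth_on_subset[OF pivot_smooth WV] smooth_on_subset[OF insert.prems(3) WV]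
          smooth_on_subset[OF insert.prems(4) WV])
        (use W in \<open>auto simp: V'_def\<close>)
    have t_sum: "(\<Sum>i\<in>I. P j i y * t i y) = (\<Sum>i\<in>I. P j i y * s i y) + P j p y * d y" for j y
    proof -
      have "(\<Sum>i\<in>I. P j i y * t i y)
          = (\<Sum>i\<in>I. P j i y * s i y + (if i = p then P j p y * d y else 0))"
        by (intro sum.cong) (auto simp: t_def distrib_left)
      then show ?thesis using y0(2) assms(2) by (simp add: sum.distrib)
    qed
    have "(\<Sum>i\<in>I. P j i y * t i y) = g j y" if "y \<in> W" "j \<in> insert m J" for y j
    proof -
      have nz: "P m p y \<noteq> 0" using that(1) W(3) by (auto simp: V'_def)
      show ?thesis
      proof (cases "j = m")
        case True
        then show ?thesis using nz by (simp add: t_sum d_def)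
      next
        case False
        have "(\<Sum>i\<in>I. P j i y * s i y) - c j y * (\<Sum>i\<in>I. P m i y * s i y)
            = g j y - c j y * g m y"
          using s[of y j] that False
          by (simp add: left_diff_distrib sum_subtractf sum_distrib_left mult.assoc)
        moreover have "P j p y * d y = c j y * (g m y - (\<Sum>i\<in>I. P m i y * s i y))"
          by (simp add: c_def d_def)
        ultimately show ?thesis by (simp add: t_sum right_diff_distrib)
      qed
    qed
    moreover have "\<forall>i\<in>I. smooth_on W (t i)"
      using W d_smooth y0(2) by (auto simp: t_def intro!: smooth_on_add)
    ultimately have "open W \<and> W \<noteq> {} \<and> W \<subseteq> V \<and> (\<forall>i\<in>I. smooth_on W (t i)) \<and>
        (\<forall>y\<in>W. \<forall>j\<in>insert m J. (\<Sum>i\<in>I. P j i y * t i y) = g j y)"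
      using W(1,2) WV by simp
    then show ?thesis by (intro exI)
  qed
qed

text \<open>
  Finitely many functionals that turn an equation between vectors into scalar equations.
\<close>

definition separating :: "('f::real_normed_vector \<Rightarrow> real) set \<Rightarrow> bool"
  where "separating H \<longleftrightarrow> finite H \<and> (\<forall>h\<in>H. bounded_linear h) \<and>
    (\<forall>v w. (\<forall>h\<in>H. h v = h w) \<longrightarrow> v = w)"

lemma separating_inner:
  fixes B :: "'e::real_inner set"
  assumes "parseval_frame B"
  shows "separating ((\<lambda>b v. v \<bullet> b) ` B)"
proof -
  have "v = w" if "\<forall>b\<in>B. v \<bullet> b = w \<bullet> b" for v w :: 'e
  proof -
    have "v = (\<Sum>b\<in>B. (v \<bullet> b) *\<^sub>R b)" using assms by (simp add: parseval_frame_def)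
    also have "\<dots> = (\<Sum>b\<in>B. (w \<bullet> b) *\<^sub>R b)" using that by simp
    also have "\<dots> = w" using assms by (simp add: parseval_frame_def)
    finally show ?thesis .
  qed
  then show ?thesis
    using assms by (auto simp: separating_def parseval_frame_def bounded_linear_inner_left)
qed

lemma separating_dual:
  assumes "parseval_frame B"
  shows "separating ((\<lambda>b \<xi>. blinfun_apply \<xi> b) ` B)"
proof -
  have "\<xi> = \<eta>" if "\<forall>b\<in>B. blinfun_apply \<xi> b = blinfun_apply \<eta> b" for \<xi> \<eta> :: "'a \<Rightarrow>\<^sub>L real"
  proof (rule blinfun_eqI)
    fix w
    note expand = linear_parseval_expansion[OF assms
        bounded_linear.linear[OF blinfun.bounded_linear_right]]
    show "blinfun_apply \<xi> w = blinfun_apply \<eta> w"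
      unfolding expand[of \<xi> w] expand[of \<eta> w] using that by simp
  qed
  then show ?thesis
    using assms by (auto simp: separating_def parseval_frame_def blinfun.bounded_linear_left)
qed

lemma separating_Pair:
  fixes G :: "('f::real_normed_vector \<Rightarrow> real) set" and H :: "('g::real_normed_vector \<Rightarrow> real) set"
  assumes "separating G" "separating H"
  shows "separating ((\<lambda>g v. g (fst v)) ` G \<union> (\<lambda>h v. h (snd v)) ` H)" (is "separating ?K")
  unfolding separating_def
proof (intro conjI ballI allI impI)
  show "finite ?K" using assms by (simp add: separating_def)
  show "bounded_linear k" if "k \<in> ?K" for k
    using that assms
    by (auto simp: separating_def intro: bounded_linear_compose[OF _ bounded_linear_fst]
        bounded_linear_compose[OF _ bounded_linear_snd])
  fix v w :: "'f \<times> 'g" assume k: "\<forall>k\<in>?K. k v = k w"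
  have "fst v = fst w" using assms(1) k unfolding separating_def ball_Un by simp
  moreover have "snd v = snd w" using assms(2) k unfolding separating_def ball_Un by simp
  ultimately show "v = w" by (rule prod_eqI)
qed

lemma smooth_vector_system:
  fixes P :: "'i \<Rightarrow> 'e::real_normed_vector \<Rightarrow> 'f::real_normed_vector"
  assumes "separating (H :: ('f \<Rightarrow> real) set)" "finite I" "open V" "V \<noteq> {}"
    and "\<And>i. i \<in> I \<Longrightarrow> smooth_on V (P i)" "smooth_on V g"
    and "\<And>y. y \<in> V \<Longrightarrow> \<exists>a. (\<Sum>i\<in>I. a i *\<^sub>R P i y) = g y"
  shows "\<exists>W s. open W \<and> W \<noteq> {} \<and> W \<subseteq> V \<and> (\<forall>i\<in>I. smooth_on W (s i)) \<and>
    (\<forall>y\<in>W. (\<Sum>i\<in>I. s i y *\<^sub>R P i y) = g y)"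
proof -
  have H: "finite H" and sep: "\<And>v w. \<forall>h\<in>H. h v = h w \<Longrightarrow> v = w"
    and lin: "\<And>h. h \<in> H \<Longrightarrow> bounded_linear h"
    using assms(1) by (simp_all add: separating_def)
  have sum: "h (\<Sum>i\<in>I. a i *\<^sub>R P i y) = (\<Sum>i\<in>I. h (P i y) * a i)" if "h \<in> H" for h a y
    using bounded_linear.linear[OF lin[OF that]]
    by (simp add: linear_sum linear_cmul mult.commute)
  have "\<exists>W s. open W \<and> W \<noteq> {} \<and> W \<subseteq> V \<and> (\<forall>i\<in>I. smooth_on W (s i)) \<and>
    (\<forall>y\<in>W. \<forall>h\<in>H. (\<Sum>i\<in>I. h (P i y) * s i y) = h (g y))"
  proof (rule smooth_linear_system[OF H assms(2-4)])
    fix y assume "y \<in> V"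
    then obtain a where "(\<Sum>i\<in>I. a i *\<^sub>R P i y) = g y" using assms(7) by blast
    then show "\<exists>a. \<forall>h\<in>H. (\<Sum>i\<in>I. h (P i y) * a i) = h (g y)"
      using sum[of _ a y] by (intro exI[of _ a]) simp
  qed (use smooth_on_bounded_linear_compose[OF lin assms(3)] assms(5,6) in simp_all)
  then obtain W s where "open W" "W \<noteq> {}" "W \<subseteq> V" "\<forall>i\<in>I. smooth_on W (s i)"
    and s: "\<forall>y\<in>W. \<forall>h\<in>H. (\<Sum>i\<in>I. h (P i y) * s i y) = h (g y)"
    by (elim exE conjE)
  moreover have "\<forall>y\<in>W. (\<Sum>i\<in>I. s i y *\<^sub>R P i y) = g y"
  proof (intro ballI sep)
    fix y h assume "y \<in> W" "h \<in> H"
    then show "h (\<Sum>i\<in>I. s i y *\<^sub>R P i y) = h (g y)"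
      using s sum[of h "\<lambda>i. s i y" y] by simp
  qed
  ultimately show ?thesis by (intro exI conjI)
qed

section \<open>Smooth fields on manifolds\<close>

lemma manifold_parseval_frame:
  fixes A :: "('a::{t2_space,second_countable_topology}, 'e::real_inner) chart set"
  assumes "smooth_manifold A"
  obtains B :: "'e set" where "parseval_frame B"
  using assms ex_parseval_frame unfolding smooth_manifold_def by blast

lemma manifold_chart:
  assumes "smooth_manifold A" "c \<in> A"
  shows "is_chart c"
  using assms unfolding smooth_manifold_def by blast

lemma cinv_cmap: "is_chart c \<Longrightarrow> x \<in> cdom c \<Longrightarrow> cinv c (cmap c x) = x"
  unfolding is_chart_def homeomorphism_def by blast

lemma cmap_cinv: "is_chart c \<Longrightarrow> y \<in> cmap c ` cdom c \<Longrightarrow> cmap c (cinv c y) = y"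
  unfolding is_chart_def homeomorphism_def by blast

lemma cinv_in_cdom: "is_chart c \<Longrightarrow> y \<in> cmap c ` cdom c \<Longrightarrow> cinv c y \<in> cdom c"
  using cinv_cmap[of c] by auto

lemma open_cdom: "is_chart c \<Longrightarrow> open (cdom c)"
  unfolding is_chart_def by blast

lemma chart_image_eq:
  assumes "is_chart c"
  shows "cmap c ` (cdom c \<inter> U) = cmap c ` cdom c \<inter> cinv c -` U"
  using cinv_cmap[OF assms] by auto

lemma open_chart_image:
  assumes "is_chart c" "open U"
  shows "open (cmap c ` (cdom c \<inter> U))"
proof -
  have "continuous_on (cmap c ` cdom c) (cinv c)" "open (cmap c ` cdom c)"
    using assms(1) unfolding is_chart_def homeomorphism_def by blast+
  then have "open (cinv c -` U \<inter> cmap c ` cdom c)"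
    using assms(2) continuous_on_open_vimage by blast
  then show ?thesis unfolding chart_image_eq[OF assms(1)] by (simp only: Int_commute)
qed

lemma open_chart_preimage:
  assumes "is_chart c" "open V"
  shows "open (cdom c \<inter> cmap c -` V)"
proof -
  have "continuous_on (cdom c) (cmap c)" "open (cdom c)"
    using assms(1) unfolding is_chart_def homeomorphism_def by blast+
  then show ?thesis using assms(2) continuous_on_open_vimage by (metis Int_commute)
qed

text \<open>
  Vector fields, one-forms and functions are treated alike: a function is a field whose
  component is the same in all charts.
\<close>

definition smooth_field_on ::
    "('a, 'e::real_normed_vector) chart set \<Rightarrow> 'a set
      \<Rightarrow> ('a \<Rightarrow> ('a, 'e) chart \<Rightarrow> 'f::real_normed_vector) \<Rightarrow> bool"
  where "smooth_field_on A U s \<longleftrightarrow> (\<forall>c\<in>A. smooth_on (cmap c ` (cdom c \<inter> U)) (rep c s))"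

abbreviation smooth_fun_on ::
    "('a, 'e::real_normed_vector) chart set \<Rightarrow> 'a set \<Rightarrow> ('a \<Rightarrow> real) \<Rightarrow> bool"
  where "smooth_fun_on A U h \<equiv> smooth_field_on A U (\<lambda>x c. h x)"

lemma smooth_field_onD:
  assumes "smooth_field_on A U s" "c \<in> A" "V \<subseteq> cmap c ` (cdom c \<inter> U)"
  shows "smooth_on V (\<lambda>y. s (cinv c y) c)"
  using assms smooth_on_subset unfolding smooth_field_on_def rep_def by blast

lemma gen_section_on_iff:
  "gen_section_on A U a \<longleftrightarrow> (\<forall>x\<in>U. a x \<in> gen_space A x) \<and>
    smooth_field_on A U (\<lambda>x. fst (a x)) \<and> smooth_field_on A U (\<lambda>x. snd (a x))"
  unfolding gen_section_on_def vector_field_on_def one_form_on_def smooth_field_on_def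
    gen_space_def by (auto simp: mem_Times_iff)

lemma smooth_field_on_subset:
  "smooth_field_on A U s \<Longrightarrow> T \<subseteq> U \<Longrightarrow> smooth_field_on A T s"
  unfolding smooth_field_on_def by (meson Int_mono image_mono order_refl smooth_on_subset)

lemma smooth_field_on_cong:
  assumes "smooth_manifold A" "open U" "\<And>x. x \<in> U \<Longrightarrow> s x = t x" "smooth_field_on A U s"
  shows "smooth_field_on A U t"
  unfolding smooth_field_on_def
proof
  fix c assume c: "c \<in> A"
  note ch = manifold_chart[OF assms(1) c]
  show "smooth_on (cmap c ` (cdom c \<inter> U)) (rep c t)"
    by (rule smooth_on_cong[of _ "rep c s"])
      (use open_chart_image[OF ch assms(2)] assms(3,4) c
       in \<open>auto simp: rep_def cinv_cmap[OF ch] smooth_field_on_def\<close>)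
qed

lemma smooth_field_on_Un:
  assumes "smooth_manifold A" "open U" "open T" "smooth_field_on A U s" "smooth_field_on A T s"
  shows "smooth_field_on A (U \<union> T) s"
  unfolding smooth_field_on_def
proof
  fix c assume c: "c \<in> A"
  note ch = manifold_chart[OF assms(1) c]
  show "smooth_on (cmap c ` (cdom c \<inter> (U \<union> T))) (rep c s)"
    unfolding Int_Un_distrib image_Un
    by (rule smooth_on_Un) (use assms c open_chart_image[OF ch] in \<open>auto simp: smooth_field_on_def\<close>)
qed

lemma smooth_field_on_zero:
  "smooth_manifold A \<Longrightarrow> open U \<Longrightarrow> smooth_field_on A U (\<lambda>x. 0)"
  unfolding smooth_field_on_def rep_def[abs_def] zero_fun_def
  by (intro ballI smooth_on_const open_chart_image manifold_chart)

lemma smooth_field_on_add: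
  assumes "smooth_manifold A" "open U" "smooth_field_on A U s" "smooth_field_on A U t"
  shows "smooth_field_on A U (\<lambda>x. s x + t x)"
  unfolding smooth_field_on_def rep_def[abs_def] plus_fun_def
  by (intro ballI smooth_on_add open_chart_image manifold_chart[OF assms(1)] assms(2)
      smooth_field_onD[OF assms(3)] smooth_field_onD[OF assms(4)] order_refl) auto

lemma smooth_field_on_scaleR:
  assumes "smooth_manifold A" "open U" "smooth_fun_on A U h" "smooth_field_on A U s"
  shows "smooth_field_on A U (\<lambda>x. h x *\<^sub>R s x)"
  unfolding smooth_field_on_def rep_def[abs_def] scaleR_fun_def
  by (intro ballI smooth_on_scaleR open_chart_image manifold_chart[OF assms(1)] assms(2)
      smooth_field_onD[OF assms(3)] smooth_field_onD[OF assms(4)] order_refl) auto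

lemma smooth_field_on_sum:
  assumes "smooth_manifold A" "open U" "\<And>i. i \<in> I \<Longrightarrow> smooth_field_on A U (s i)"
  shows "smooth_field_on A U (\<lambda>x. \<Sum>i\<in>I. s i x)"
  using assms(3)
  by (induction I rule: infinite_finite_induct)
    (auto intro: smooth_field_on_zero smooth_field_on_add assms(1,2))

text \<open>
  In another chart the function becomes the composition of \<open>h\<close> with a transition map.
\<close>

lemma smooth_fun_on_chart_function:
  fixes A :: "('a::{t2_space,second_countable_topology}, 'e::real_inner) chart set"
  assumes A: "smooth_manifold A" and c: "c \<in> A" and V: "open V" and h: "smooth_on V h"
  shows "smooth_fun_on A (cdom c \<inter> cmap c -` V) (\<lambda>x. h (cmap c x))"
  unfolding smooth_field_on_def
proof
  fix c' assume c': "c' \<in> A"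
  note ch = manifold_chart[OF A c] and ch' = manifold_chart[OF A c']
  obtain B :: "'e set" where B: "parseval_frame B" by (rule manifold_parseval_frame[OF A])
  let ?S = "cmap c' ` (cdom c' \<inter> (cdom c \<inter> cmap c -` V))"
  have S: "open ?S" by (intro open_chart_image ch' open_chart_preimage ch V)
  have "smooth_on (cmap c' ` (cdom c' \<inter> cdom c)) (transition c' c)"
    using A c c' unfolding smooth_manifold_def by blast
  then have "smooth_on ?S (transition c' c)" by (rule smooth_on_subset) auto
  moreover have "transition c' c ` ?S \<subseteq> V"
    by (auto simp: transition_def cinv_cmap[OF ch'])
  ultimately have "smooth_on ?S (\<lambda>y. h (transition c' c y))"
    using smooth_on_compose[OF B S V] h by blast
  then show "smooth_on ?S (rep c' (\<lambda>x _. h (cmap c x)))"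
    by (simp add: transition_def rep_def[abs_def])
qed

text \<open>
  The open set \<open>N\<close> and the complement of the support \<open>K\<close> cover the manifold.
\<close>

lemma smooth_field_on_extend_by_zero:
  assumes A: "smooth_manifold A" and N: "open N" and K: "closed K" "K \<subseteq> N"
    and s: "smooth_field_on A N s" and zero: "\<And>x. x \<notin> K \<Longrightarrow> s' x = 0"
    and eq: "\<And>x. x \<in> N \<Longrightarrow> s' x = s x"
  shows "smooth_field_on A UNIV s'"
proof -
  have "smooth_field_on A N s'" using smooth_field_on_cong[OF A N _ s] eq by simp
  moreover have "smooth_field_on A (- K) s'"
    using smooth_field_on_cong[OF A _ _ smooth_field_on_zero[OF A], of "- K" s'] K zero by auto
  ultimately have "smooth_field_on A (N \<union> - K) s'"
    using smooth_field_on_Un[OF A N] K by blast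
  moreover have "N \<union> - K = UNIV" using K by blast
  ultimately show ?thesis by simp
qed

text \<open>
  A plateau function on the model space, supported in a closed ball inside a chart image, is pulled
  back. The preimage of the ball is compact and, the manifold being Hausdorff, closed, so the
  extension by zero is smooth. The plateau around \<open>x\<close> leaves derivatives at \<open>x\<close> untouched
  when fields are multiplied by the bump function.
\<close>

lemma ex_bump_function:
  fixes A :: "('a::{t2_space,second_countable_topology}, 'e::real_inner) chart set"
  assumes A: "smooth_manifold A" and W: "open W" "x \<in> W"
  shows "\<exists>\<phi> K N. smooth_fun_on A UNIV \<phi> \<and> closed K \<and> K \<subseteq> W \<and> (\<forall>z. z \<notin> K \<longrightarrow> \<phi> z = 0) \<and>
    open N \<and> x \<in> N \<and> N \<subseteq> W \<and> (\<forall>z\<in>N. \<phi> z = 1)"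
proof -
  obtain c where c: "c \<in> A" "x \<in> cdom c"
    using A unfolding smooth_manifold_def by blast
  note ch = manifold_chart[OF A c(1)]
  obtain B :: "'e set" where B: "parseval_frame B" by (rule manifold_parseval_frame[OF A])
  have "cmap c x \<in> cmap c ` (cdom c \<inter> W)" using c(2) W(2) by blast
  then obtain r where r: "r > 0" "cball (cmap c x) r \<subseteq> cmap c ` (cdom c \<inter> W)"
    using open_contains_cball_eq[OF open_chart_image[OF ch W(1)]] by blast
  obtain \<psi> :: "'e \<Rightarrow> real" where \<psi>: "smooth_on UNIV \<psi>" "\<And>y. dist (cmap c x) y < r / 2 \<Longrightarrow> \<psi> y = 1"
    "\<And>y. y \<notin> cball (cmap c x) r \<Longrightarrow> \<psi> y = 0"
    using ex_smooth_plateau[OF r(1), of "cmap c x"] by blast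
  define K where "K = cinv c ` cball (cmap c x) r"
  define \<phi> where "\<phi> = (\<lambda>z. if z \<in> cdom c then \<psi> (cmap c z) else 0)"
  define N where "N = cdom c \<inter> cmap c -` ball (cmap c x) (r / 2)"
  have "continuous_on (cmap c ` cdom c) (cinv c)"
    using ch unfolding is_chart_def homeomorphism_def by blast
  then have "continuous_on (cball (cmap c x) r) (cinv c)"
    by (rule continuous_on_subset) (use r(2) in auto)
  then have K: "closed K"
    unfolding K_def
    by (intro compact_imp_closed compact_continuous_image compact_cball_if_parseval_frame[OF B])
  have KW: "K \<subseteq> cdom c \<inter> W"
    unfolding K_def using r(2) cinv_cmap[OF ch] by force
  have inK: "z \<in> K" if "z \<in> cdom c" "cmap c z \<in> cball (cmap c x) r" for z
    unfolding K_def using that cinv_cmap[OF ch that(1)] by (metis imageI)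
  have zero: "\<phi> z = 0" if "z \<notin> K" for z
    using that \<psi>(3) inK unfolding \<phi>_def by auto
  have plateau: "smooth_fun_on A (cdom c) (\<lambda>z. \<psi> (cmap c z))"
    using smooth_fun_on_chart_function[OF A c(1) open_UNIV \<psi>(1)] by simp
  have "smooth_fun_on A UNIV \<phi>"
    by (rule smooth_field_on_extend_by_zero[OF A open_cdom[OF ch] K _ plateau])
      (use KW zero in \<open>auto simp: \<phi>_def zero_fun_def\<close>)
  moreover have "N \<subseteq> K" unfolding N_def using inK r(1) by force
  moreover have "open N" unfolding N_def by (intro open_chart_preimage ch open_ball)
  moreover have "x \<in> N" using c(2) r(1) by (simp add: N_def)
  moreover have "\<phi> z = 1" if "z \<in> N" for z using that \<psi>(2) by (simp add: N_def \<phi>_def)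
  ultimately show ?thesis using K KW zero by (intro exI[of _ \<phi>] exI[of _ K] exI[of _ N]) auto
qed

section \<open>Lagrangian families in a chart\<close>

lemma ev_in_chart:
  assumes "c \<in> charts_at A x" "v \<in> tangent_space A x" "\<xi> \<in> cotangent_space A x"
  shows "ev A x v \<xi> = blinfun_apply (\<xi> c) (v c)"
proof -
  define d where "d = (SOME c. c \<in> charts_at A x)"
  have d: "d \<in> charts_at A x" unfolding d_def using assms(1) by (rule someI)
  have "v d = dtrans c d x (v c)" using assms d unfolding tangent_space_def by blast
  moreover have "blinfun_apply (\<xi> c) (v c) = blinfun_apply (\<xi> d) (dtrans c d x (v c))"
    using assms d unfolding cotangent_space_def by blast
  ultimately show ?thesis by (simp add: ev_def d_def Let_def)
qed

lemma tangent_space_eqI: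
  assumes "c \<in> charts_at A x" "v \<in> tangent_space A x" "w \<in> tangent_space A x" "v c = w c"
  shows "v = w"
proof
  fix d
  show "v d = w d"
  proof (cases "d \<in> charts_at A x")
    case True
    then have "v d = dtrans c d x (v c)" "w d = dtrans c d x (w c)"
      using assms unfolding tangent_space_def by blast+
    then show ?thesis using assms(4) by simp
  next
    case False
    then have "v d = 0" "w d = 0" using assms(2,3) unfolding tangent_space_def by blast+
    then show ?thesis by simp
  qed
qed

lemma cotangent_space_eqI:
  assumes "c \<in> charts_at A x" "\<xi> \<in> cotangent_space A x" "\<eta> \<in> cotangent_space A x" "\<xi> c = \<eta> c"
  shows "\<xi> = \<eta>"
proof
  fix d
  show "\<xi> d = \<eta> d"
  proof (cases "d \<in> charts_at A x")
    case True
    show ?thesis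
    proof (rule blinfun_eqI)
      fix w
      have "blinfun_apply (\<xi> d) w = blinfun_apply (\<xi> c) (dtrans d c x w)"
        "blinfun_apply (\<eta> d) w = blinfun_apply (\<eta> c) (dtrans d c x w)"
        using assms True unfolding cotangent_space_def by blast+
      then show "blinfun_apply (\<xi> d) w = blinfun_apply (\<eta> d) w" using assms(4) by simp
    qed
  next
    case False
    then have "\<xi> d = 0" "\<eta> d = 0" using assms(2,3) unfolding cotangent_space_def by blast+
    then show ?thesis by simp
  qed
qed

lemma lagrangian_family_subset_gen_space:
  "lagrangian_family A L \<Longrightarrow> (v, \<xi>) \<in> L x \<Longrightarrow> v \<in> tangent_space A x \<and> \<xi> \<in> cotangent_space A x"
  unfolding lagrangian_family_def gen_space_def by blast

lemma lagrangian_family_subspace: "lagrangian_family A L \<Longrightarrow> subspace (L x)"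
  unfolding lagrangian_family_def by blast

lemma lagrangian_family_pairing_in_chart:
  assumes "lagrangian_family A L" "(v, \<xi>) \<in> L x" "(w, \<eta>) \<in> L x" "c \<in> charts_at A x"
  shows "blinfun_apply (\<xi> c) (w c) + blinfun_apply (\<eta> c) (v c) = 0"
proof -
  have "pairing A x (v, \<xi>) (w, \<eta>) = 0"
    using assms(1-3) unfolding lagrangian_family_def perp_def by blast
  then show ?thesis
    using lagrangian_family_subset_gen_space[OF assms(1,2)]
      lagrangian_family_subset_gen_space[OF assms(1,3)]
    by (simp add: pairing_def ev_in_chart[OF assms(4)])
qed

lemma sections_iff:
  assumes "lagrangian_family A L"
  shows "a \<in> sections A L \<longleftrightarrow> smooth_field_on A UNIV (\<lambda>x. fst (a x)) \<and>
    smooth_field_on A UNIV (\<lambda>x. snd (a x)) \<and> (\<forall>x. a x \<in> L x)"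
proof -
  have "L x \<subseteq> gen_space A x" for x using assms unfolding lagrangian_family_def by blast
  then have "a x \<in> gen_space A x" if "a x \<in> L x" for x using that by blast
  then show ?thesis by (auto simp: sections_def gen_section_on_iff)
qed

lemma local_frame_expansion:
  assumes "local_frame A L U k e" "x \<in> U" "l \<in> L x"
  obtains a where "l = (\<Sum>i<k. a i *\<^sub>R e i x)"
proof -
  have inj: "inj_on (\<lambda>i. e i x) {..<k}" and span: "l \<in> span ((\<lambda>i. e i x) ` {..<k})"
    using assms unfolding local_frame_def by auto
  from span obtain b where "l = (\<Sum>v\<in>(\<lambda>i. e i x) ` {..<k}. b v *\<^sub>R v)"
    by (auto simp: span_finite)
  then have "l = (\<Sum>i<k. b (e i x) *\<^sub>R e i x)"
    by (simp add: sum.reindex[OF inj])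
  then show ?thesis by (rule that[of "\<lambda>i. b (e i x)"])
qed

lemma local_frame_combination:
  assumes "local_frame A L U k e" "x \<in> U"
  shows "(\<Sum>i<k. a i *\<^sub>R e i x) \<in> L x"
proof -
  have "(\<Sum>i<k. a i *\<^sub>R e i x) \<in> span ((\<lambda>i. e i x) ` {..<k})"
    by (intro span_sum span_scale span_base) auto
  then show ?thesis using assms unfolding local_frame_def by auto
qed

lemma sum_fun_apply: "(\<Sum>i\<in>I. f i) c = (\<Sum>i\<in>I. f i c)"
  by (induction I rule: infinite_finite_induct) auto

text \<open>
  The unknowns are the coefficients of \<open>u + \<xi>\<close> in a frame of \<open>L\<close> and those of \<open>v + \<xi>\<close> in a frame
  of \<open>R\<close>; the equations say that the vector parts are \<open>u\<close> and \<open>v\<close> and that the two form parts agree.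
  Smooth coefficients give sections of \<open>L\<close> and \<open>R\<close>, so that \<open>\<xi>\<close> is smooth in all charts and
  membership is automatic. It is enough to write the equations in one chart.
\<close>

lemma ex_smooth_common_form:
  fixes A :: "('a::{t2_space,second_countable_topology}, 'e::real_inner) chart set"
    and L R :: "('a, 'e) family"
  assumes A: "smooth_manifold A" and c: "c \<in> A"
    and L: "lagrangian_family A L" "smooth_family A L"
    and R: "lagrangian_family A R" "smooth_family A R"
    and u: "smooth_field_on A UNIV u" and v: "smooth_field_on A UNIV v"
    and ex: "\<And>x. \<exists>\<xi>. (u x, \<xi>) \<in> L x \<and> (v x, \<xi>) \<in> R x"
    and V: "open V" "V \<noteq> {}" "V \<subseteq> cmap c ` cdom c"
  obtains W \<xi> where "open W" "W \<noteq> {}" "W \<subseteq> V" "smooth_field_on A (cdom c \<inter> cmap c -` W) \<xi>"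
    "\<forall>x\<in>cdom c \<inter> cmap c -` W. (u x, \<xi> x) \<in> L x \<and> (v x, \<xi> x) \<in> R x"
proof -
  note ch = manifold_chart[OF A c]
  obtain B :: "'e set" where B: "parseval_frame B" by (rule manifold_parseval_frame[OF A])
  obtain y0 where y0: "y0 \<in> V" using V(2) by blast
  obtain UL k e where UL: "open UL" "cinv c y0 \<in> UL" and e: "local_frame A L UL k e"
    using L(2) unfolding smooth_family_def by blast
  obtain UR l f where UR: "open UR" "cinv c y0 \<in> UR" and f: "local_frame A R UR l f"
    using R(2) unfolding smooth_family_def by blast
  define U where "U = UL \<inter> UR"
  have U: "open U" unfolding U_def using UL(1) UR(1) by (rule open_Int)
  define V' where "V' = V \<inter> cmap c ` (cdom c \<inter> U)"
  have V': "open V'" "V' \<subseteq> V" "V' \<subseteq> cmap c ` (cdom c \<inter> U)"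
    unfolding V'_def using V(1) open_chart_image[OF ch U] by auto
  have "y0 \<in> V'"
    using y0 V(3) UL(2) UR(2) by (auto simp: V'_def U_def chart_image_eq[OF ch])
  then have V'_ne: "V' \<noteq> {}" by blast
  have e_smooth: "smooth_field_on A U (\<lambda>x. fst (e i x))" "smooth_field_on A U (\<lambda>x. snd (e i x))"
    if "i < k" for i
    using e that smooth_field_on_subset[of A UL _ U]
    by (auto simp: local_frame_def gen_section_on_iff U_def)
  have f_smooth: "smooth_field_on A U (\<lambda>x. fst (f j x))" "smooth_field_on A U (\<lambda>x. snd (f j x))"
    if "j < l" for j
    using f that smooth_field_on_subset[of A UR _ U]
    by (auto simp: local_frame_def gen_section_on_iff U_def)
  have in_U: "cinv c y \<in> cdom c \<inter> U" if "y \<in> V'" for y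
    using that V'(3) cinv_cmap[OF ch] by auto
  have at: "c \<in> charts_at A x" if "x \<in> cdom c" for x
    using c that by (simp add: charts_at_def)

  \<comment> \<open>The unknowns are the coefficients of \<open>e\<close> (left summand) and of \<open>f\<close> (right summand).\<close>
  define P where "P = (\<lambda>i y. case i of
      Inl i \<Rightarrow> (fst (e i (cinv c y)) c, 0, snd (e i (cinv c y)) c)
    | Inr j \<Rightarrow> (0, fst (f j (cinv c y)) c, - snd (f j (cinv c y)) c))"
  define g where "g = (\<lambda>y. (u (cinv c y) c, v (cinv c y) c, 0 :: 'e \<Rightarrow>\<^sub>L real))"
  define I where "I = {..<k} <+> {..<l}"
  have P_sum: "(\<Sum>i\<in>I. a i *\<^sub>R P i y) =
      (fst (\<Sum>i<k. a (Inl i) *\<^sub>R e i (cinv c y)) c, fst (\<Sum>j<l. a (Inr j) *\<^sub>R f j (cinv c y)) c,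
       snd (\<Sum>i<k. a (Inl i) *\<^sub>R e i (cinv c y)) c - snd (\<Sum>j<l. a (Inr j) *\<^sub>R f j (cinv c y)) c)"
    for a y
    by (simp add: I_def P_def sum.Plus sum_prod fst_sum snd_sum sum_fun_apply scaleR_fun_def
        sum_negf)
  have "\<exists>W s. open W \<and> W \<noteq> {} \<and> W \<subseteq> V' \<and> (\<forall>i\<in>I. smooth_on W (s i)) \<and>
    (\<forall>y\<in>W. (\<Sum>i\<in>I. s i y *\<^sub>R P i y) = g y)"
  proof (rule smooth_vector_system[OF _ _ V'(1) V'_ne])
    show "separating ((\<lambda>g v. g (fst v)) ` (\<lambda>b v. v \<bullet> b) ` B \<union>
       (\<lambda>h v. h (snd v)) ` ((\<lambda>g v. g (fst v)) ` (\<lambda>b v. v \<bullet> b) ` B \<union>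
       (\<lambda>h v. h (snd v)) ` (\<lambda>b \<xi>. blinfun_apply \<xi> b) ` B))"
      by (intro separating_Pair separating_inner separating_dual B)
    show "finite I" by (simp add: I_def)
    show "smooth_on V' (P i)" if "i \<in> I" for i
      using that unfolding I_def P_def
      by (auto intro!: smooth_on_Pair smooth_on_minus smooth_on_const V'
          smooth_field_onD[OF e_smooth(1) c V'(3)] smooth_field_onD[OF e_smooth(2) c V'(3)]
          smooth_field_onD[OF f_smooth(1) c V'(3)] smooth_field_onD[OF f_smooth(2) c V'(3)])
    have "V' \<subseteq> cmap c ` (cdom c \<inter> UNIV)" using V'(3) by auto
    then show "smooth_on V' g"
      unfolding g_def
      by (intro smooth_on_Pair smooth_on_const V' smooth_field_onD[OF u c]
          smooth_field_onD[OF v c])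
    fix y assume y: "y \<in> V'"
    obtain \<xi> where \<xi>: "(u (cinv c y), \<xi>) \<in> L (cinv c y)" "(v (cinv c y), \<xi>) \<in> R (cinv c y)"
      using ex by blast
    have yU: "cinv c y \<in> UL" "cinv c y \<in> UR" using in_U[OF y] by (auto simp: U_def)
    obtain a where a: "(u (cinv c y), \<xi>) = (\<Sum>i<k. a i *\<^sub>R e i (cinv c y))"
      by (rule local_frame_expansion[OF e yU(1) \<xi>(1)])
    obtain b where b: "(v (cinv c y), \<xi>) = (\<Sum>j<l. b j *\<^sub>R f j (cinv c y))"
      by (rule local_frame_expansion[OF f yU(2) \<xi>(2)])
    have "(\<Sum>i\<in>I. case_sum a b i *\<^sub>R P i y) = g y"
      unfolding P_sum by (simp add: g_def flip: a b)
    then show "\<exists>a. (\<Sum>i\<in>I. a i *\<^sub>R P i y) = g y" by blast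
  qed
  then obtain W s where W: "open W" "W \<noteq> {}" "W \<subseteq> V'" and s: "\<forall>i\<in>I. smooth_on W (s i)"
    and eq: "\<forall>y\<in>W. (\<Sum>i\<in>I. s i y *\<^sub>R P i y) = g y"
    by (elim exE conjE)
  define N where "N = cdom c \<inter> cmap c -` W"
  have N: "open N" unfolding N_def by (rule open_chart_preimage[OF ch W(1)])
  have NU: "N \<subseteq> U"
    using in_U W(3) cinv_cmap[OF ch] unfolding N_def by fastforce
  define \<sigma> where "\<sigma> = (\<lambda>x. \<Sum>i<k. s (Inl i) (cmap c x) *\<^sub>R e i x)"
  define \<rho> where "\<rho> = (\<lambda>x. \<Sum>j<l. s (Inr j) (cmap c x) *\<^sub>R f j x)"
  have "(u x, snd (\<sigma> x)) \<in> L x \<and> (v x, snd (\<sigma> x)) \<in> R x" if x: "x \<in> N" for x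
  proof -
    have xc: "x \<in> cdom c" "cmap c x \<in> W" "cinv c (cmap c x) = x"
      using x cinv_cmap[OF ch] by (auto simp: N_def)
    have \<sigma>: "\<sigma> x \<in> L x" and \<rho>: "\<rho> x \<in> R x"
      unfolding \<sigma>_def \<rho>_def
      using local_frame_combination[OF e] local_frame_combination[OF f] x NU
      by (auto simp: U_def)
    have comps: "fst (\<sigma> x) c = u x c" "fst (\<rho> x) c = v x c" "snd (\<sigma> x) c = snd (\<rho> x) c"
      using bspec[OF eq xc(2)] unfolding P_sum by (simp_all add: g_def xc(3) \<sigma>_def \<rho>_def)
    obtain \<xi> where \<xi>: "(u x, \<xi>) \<in> L x" "(v x, \<xi>) \<in> R x" using ex by blast
    have gen: "fst (\<sigma> x) \<in> tangent_space A x" "snd (\<sigma> x) \<in> cotangent_space A x"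
        "fst (\<rho> x) \<in> tangent_space A x" "snd (\<rho> x) \<in> cotangent_space A x"
        "u x \<in> tangent_space A x" "v x \<in> tangent_space A x"
      using lagrangian_family_subset_gen_space[OF L(1)] lagrangian_family_subset_gen_space[OF R(1)]
        \<sigma> \<rho> \<xi> by (metis prod.collapse)+
    have "fst (\<sigma> x) = u x" by (rule tangent_space_eqI[OF at[OF xc(1)] gen(1,5) comps(1)])
    moreover have "fst (\<rho> x) = v x" by (rule tangent_space_eqI[OF at[OF xc(1)] gen(3,6) comps(2)])
    moreover have "snd (\<sigma> x) = snd (\<rho> x)"
      by (rule cotangent_space_eqI[OF at[OF xc(1)] gen(2,4) comps(3)])
    ultimately show ?thesis using \<sigma> \<rho> by (metis prod.collapse)
  qed
  moreover have "smooth_field_on A N (\<lambda>x. snd (\<sigma> x))"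
  proof -
    have "smooth_field_on A N (\<lambda>x. \<Sum>i<k. s (Inl i) (cmap c x) *\<^sub>R snd (e i x))"
    proof (intro smooth_field_on_sum smooth_field_on_scaleR A N)
      fix i assume "i \<in> {..<k}"
      then show "smooth_fun_on A N (\<lambda>x. s (Inl i) (cmap c x))"
        "smooth_field_on A N (\<lambda>x. snd (e i x))"
        using s smooth_fun_on_chart_function[OF A c W(1)]
          smooth_field_on_subset[OF e_smooth(2) NU]
        by (auto simp: N_def I_def)
    qed
    then show ?thesis by (simp add: \<sigma>_def snd_sum)
  qed
  moreover have "W \<subseteq> V" using W(3) V'(2) by blast
  ultimately show ?thesis using that[of W "\<lambda>x. snd (\<sigma> x)"] W unfolding N_def by blast
qed

section \<open>Brackets and torsion in a chart\<close>

definition bracket_in ::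
    "('a, 'e::real_normed_vector) chart \<Rightarrow> ('a \<Rightarrow> ('a, 'e) tvec) \<Rightarrow> ('a \<Rightarrow> ('a, 'e) tvec) \<Rightarrow> 'a \<Rightarrow> 'e"
  where "bracket_in c u v x = drep c v x (u x c) - drep c u x (v x c)"

text \<open>
  The form part of the Dorfman bracket \<open>[u + \<xi>, v + \<eta>]\<close> at \<open>x\<close>, evaluated on the vector with
  component \<open>w\<close>.
\<close>

definition dorfman_form_in ::
    "('a, 'e::real_normed_vector) chart \<Rightarrow> ('a \<Rightarrow> ('a, 'e) tvec) \<Rightarrow> ('a \<Rightarrow> ('a, 'e) covec)
      \<Rightarrow> ('a \<Rightarrow> ('a, 'e) tvec) \<Rightarrow> ('a \<Rightarrow> ('a, 'e) covec) \<Rightarrow> 'a \<Rightarrow> 'e \<Rightarrow> real"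
  where "dorfman_form_in c u \<xi> v \<eta> x w =
    blinfun_apply (drep c \<eta> x (u x c)) w + blinfun_apply (\<eta> x c) (drep c u x w)
    - (blinfun_apply (drep c \<xi> x (v x c)) w - blinfun_apply (drep c \<xi> x w) (v x c))"

lemma drep_has_derivative:
  assumes "smooth_field_on A UNIV s" "c \<in> charts_at A x"
  shows "(rep c s has_derivative drep c s x) (at (cmap c x))"
proof -
  have c: "c \<in> A" "x \<in> cdom c" using assms(2) by (auto simp: charts_at_def)
  then have "smooth_on (cmap c ` cdom c) (rep c s)"
    using assms(1) by (simp add: smooth_field_on_def)
  then show ?thesis
    unfolding drep_def by (rule smooth_on_imp_has_derivative) (use c in blast)
qed

lemma linear_drep:
  "smooth_field_on A UNIV s \<Longrightarrow> c \<in> charts_at A x \<Longrightarrow> linear (drep c s x)"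
  by (rule has_derivative_linear[OF drep_has_derivative])

lemma drep_add:
  assumes "smooth_field_on A UNIV s" "smooth_field_on A UNIV t" "c \<in> charts_at A x"
  shows "drep c (\<lambda>x. s x + t x) x w = drep c s x w + drep c t x w"
proof -
  have "((\<lambda>y. rep c s y + rep c t y) has_derivative (\<lambda>w. drep c s x w + drep c t x w))
      (at (cmap c x))"
    by (rule has_derivative_add[OF drep_has_derivative[OF assms(1,3)]
          drep_has_derivative[OF assms(2,3)]])
  then have "(\<lambda>w. drep c s x w + drep c t x w) = drep c (\<lambda>x. s x + t x) x"
    unfolding drep_def[of c "\<lambda>x. s x + t x"]
    by (intro frechet_derivative_at) (simp add: rep_def[abs_def])
  then show ?thesis by metis
qed

lemma drep_cong:
  assumes "smooth_manifold A" "c \<in> charts_at A x" "open N" "x \<in> N"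
    and "\<And>z. z \<in> N \<Longrightarrow> s z = t z" "smooth_field_on A UNIV s"
  shows "drep c s x = drep c t x"
proof -
  have c: "c \<in> A" "x \<in> cdom c" using assms(2) by (auto simp: charts_at_def)
  note ch = manifold_chart[OF assms(1) c(1)]
  have diff: "rep c s differentiable (at (cmap c x))"
    using drep_has_derivative[OF assms(6,2)] by (rule differentiableI)
  have inS: "cmap c x \<in> cmap c ` (cdom c \<inter> N)" using c assms(4) by blast
  have eq: "rep c s y = rep c t y" if "y \<in> cmap c ` (cdom c \<inter> N)" for y
    using that assms(5) by (auto simp: rep_def cinv_cmap[OF ch])
  show ?thesis
    unfolding drep_def
    by (rule frechet_derivative_transform_within_open[OF diff open_chart_image[OF ch assms(3)] inS eq])
qed

lemma bracket_in_cong: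
  assumes "smooth_manifold A" "c \<in> charts_at A x" "open N" "x \<in> N"
    and "\<And>z. z \<in> N \<Longrightarrow> u z = u' z" "\<And>z. z \<in> N \<Longrightarrow> v z = v' z"
    and "smooth_field_on A UNIV u" "smooth_field_on A UNIV v"
  shows "bracket_in c u v x = bracket_in c u' v' x"
  using drep_cong[OF assms(1-4) assms(5,7)] drep_cong[OF assms(1-4) assms(6,8)] assms(4-6)
  by (simp add: bracket_in_def)

lemma smooth_on_bracket_in:
  fixes A :: "('a::{t2_space,second_countable_topology}, 'e::real_inner) chart set"
  assumes A: "smooth_manifold A" and c: "c \<in> A"
    and u: "smooth_field_on A UNIV u" and v: "smooth_field_on A UNIV v"
  shows "smooth_on (cmap c ` cdom c) (\<lambda>y. bracket_in c u v (cinv c y))"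
proof -
  note ch = manifold_chart[OF A c]
  obtain B :: "'e set" where B: "parseval_frame B" by (rule manifold_parseval_frame[OF A])
  have S: "open (cmap c ` cdom c)" using ch unfolding is_chart_def by blast
  have rep: "smooth_on (cmap c ` cdom c) (rep c u)" "smooth_on (cmap c ` cdom c) (rep c v)"
    using u v c unfolding smooth_field_on_def by auto
  have "smooth_on (cmap c ` cdom c) (\<lambda>y. frechet_derivative (rep c v) (at y) (rep c u y)
      - frechet_derivative (rep c u) (at y) (rep c v y))"
    by (intro smooth_on_diff smooth_on_derivative_along[OF B] S rep)
  then show ?thesis
    by (rule smooth_on_cong[OF S, rotated])
      (simp add: bracket_in_def drep_def rep_def[abs_def] cmap_cinv[OF ch])
qed

lemma dorfman_in_chart:
  assumes "c \<in> charts_at A x"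
    and u: "smooth_field_on A UNIV u" and v: "smooth_field_on A UNIV v"
    and \<xi>: "smooth_field_on A UNIV \<xi>" and \<eta>: "smooth_field_on A UNIV \<eta>"
  shows "fst (dorfman A (\<lambda>x. (u x, \<xi> x)) (\<lambda>x. (v x, \<eta> x)) x) c = bracket_in c u v x"
    and "blinfun_apply (snd (dorfman A (\<lambda>x. (u x, \<xi> x)) (\<lambda>x. (v x, \<eta> x)) x) c) w
      = dorfman_form_in c u \<xi> v \<eta> x w"
proof -
  note bounded = has_derivative_bounded_linear[OF drep_has_derivative[OF _ assms(1)]]
  show "fst (dorfman A (\<lambda>x. (u x, \<xi> x)) (\<lambda>x. (v x, \<eta> x)) x) c = bracket_in c u v x"
    using assms(1) by (simp add: dorfman_def lie_bracket_def bracket_in_def)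
  have "bounded_linear (\<lambda>w. blinfun_apply (drep c \<eta> x (u x c)) w
      + blinfun_apply (\<eta> x c) (drep c u x w))"
    by (intro bounded_linear_add blinfun.bounded_linear_right
        bounded_linear_compose[OF blinfun.bounded_linear_right bounded[OF u]])
  moreover have "bounded_linear (\<lambda>w. blinfun_apply (drep c \<xi> x (v x c)) w
      - blinfun_apply (drep c \<xi> x w) (v x c))"
    by (intro bounded_linear_sub blinfun.bounded_linear_right
        bounded_linear_compose[OF blinfun.bounded_linear_left bounded[OF \<xi>]])
  ultimately show "blinfun_apply (snd (dorfman A (\<lambda>x. (u x, \<xi> x)) (\<lambda>x. (v x, \<eta> x)) x) c) w
      = dorfman_form_in c u \<xi> v \<eta> x w"
    using assms(1)
    by (simp add: dorfman_def lie_derivative_def interior_def ext_derivative_def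
        dorfman_form_in_def bounded_linear_Blinfun_apply blinfun.diff_left)
qed

text \<open>
  The bracket of two sections of a Dirac structure is again a section, hence orthogonal to every
  element of the fibre.
\<close>

lemma dirac_structure_pairing:
  assumes L: "dirac_structure A L" and c: "c \<in> charts_at A x"
    and u: "smooth_field_on A UNIV u" and v: "smooth_field_on A UNIV v"
    and \<xi>: "smooth_field_on A UNIV \<xi>" and \<eta>: "smooth_field_on A UNIV \<eta>"
    and in_L: "\<And>x. (u x, \<xi> x) \<in> L x" "\<And>x. (v x, \<eta> x) \<in> L x" and l: "(w, \<zeta>) \<in> L x"
  shows "blinfun_apply (\<zeta> c) (bracket_in c u v x) = - dorfman_form_in c u \<xi> v \<eta> x (w c)"
proof -
  have lag: "lagrangian_family A L" using L unfolding dirac_structure_def by blast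
  have "(\<lambda>x. (u x, \<xi> x)) \<in> sections A L" "(\<lambda>x. (v x, \<eta> x)) \<in> sections A L"
    using u v \<xi> \<eta> in_L by (simp_all add: sections_iff[OF lag])
  then have "dorfman A (\<lambda>x. (u x, \<xi> x)) (\<lambda>x. (v x, \<eta> x)) \<in> sections A L" (is "?d \<in> _")
    using L unfolding dirac_structure_def by blast
  then have "(fst (?d x), snd (?d x)) \<in> L x" by (simp add: sections_iff[OF lag])
  from lagrangian_family_pairing_in_chart[OF lag this l c] show ?thesis
    by (simp add: dorfman_in_chart[OF c u v \<xi> \<eta>])
qed

definition torsion_in ::
    "('a, 'e::real_normed_vector) chart \<Rightarrow> ('a, 'e) torsion_arg \<Rightarrow> 'a \<Rightarrow> real"
  where "torsion_in c = (\<lambda>(uL, uR, vL, vR, \<zeta>L, \<zeta>LR, \<zeta>R) x.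
    blinfun_apply (\<zeta>L x c) (bracket_in c uL vL x)
    - blinfun_apply (\<zeta>LR x c) (bracket_in c uL vR x + bracket_in c uR vL x)
    + blinfun_apply (\<zeta>R x c) (bracket_in c uR vR x))"

text \<open>
  Evaluating a covector on a vector uses an arbitrarily chosen chart, which may vary from point to
  point.
\<close>

lemma torsion_eq_torsion_in:
  assumes "smooth_manifold A"
  shows "\<exists>c\<in>charts_at A x. torsion A p x = torsion_in c p x"
proof -
  have "\<exists>c. c \<in> charts_at A x"
    using assms unfolding smooth_manifold_def charts_at_def by blast
  then have c: "(SOME c. c \<in> charts_at A x) \<in> charts_at A x" by (rule someI_ex)
  show ?thesis
    by (rule bexI[OF _ c]) (use c in \<open>auto simp: torsion_def torsion_in_def ev_def Let_def
      lie_bracket_def bracket_in_def split: prod.split\<close>)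
qed

text \<open>
  Write \<open>a\<close> and \<open>b\<close> for the form parts of the brackets \<open>[u\<^sub>L + \<xi>, v\<^sub>L + \<eta>]\<close> and
  \<open>[u\<^sub>R + \<xi>, v\<^sub>R + \<eta>]\<close>. Orthogonality in \<open>L\<close> and \<open>R\<close> gives
  \<open>\<zeta>\<^sub>L([u\<^sub>L, v\<^sub>L]) = - a(w)\<close>, \<open>\<zeta>\<^sub>L\<^sub>R([u\<^sub>L, v\<^sub>L]) = - a(z)\<close>,
  \<open>\<zeta>\<^sub>L\<^sub>R([u\<^sub>R, v\<^sub>R]) = - b(w)\<close> and \<open>\<zeta>\<^sub>R([u\<^sub>R, v\<^sub>R]) = - b(z)\<close>. The element
  \<open>z + w + \<zeta>\<^sub>L\<^sub>R\<close> of the cotangent product gives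
  \<open>\<zeta>\<^sub>L\<^sub>R([u\<^sub>L + u\<^sub>R, v\<^sub>L + v\<^sub>R]) = - (a + b)(z + w)\<close>. Hence the mixed brackets
  contribute \<open>\<zeta>\<^sub>L\<^sub>R([u\<^sub>L, v\<^sub>R] + [u\<^sub>R, v\<^sub>L]) = - a(w) - b(z)\<close>, which cancels the two outer
  terms of the torsion.
\<close>

lemma torsion_in_zero_of_common_forms:
  assumes L: "dirac_structure A L" and R: "dirac_structure A R"
    and Q: "dirac_structure A (cotangent_product L R)"
    and A: "smooth_manifold A" and c: "c \<in> charts_at A x"
    and uL: "smooth_field_on A UNIV uL" and uR: "smooth_field_on A UNIV uR"
    and vL: "smooth_field_on A UNIV vL" and vR: "smooth_field_on A UNIV vR"
    and \<xi>: "smooth_field_on A UNIV \<xi>" and \<eta>: "smooth_field_on A UNIV \<eta>"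
    and uL_in: "\<And>x. (uL x, \<xi> x) \<in> L x" and uR_in: "\<And>x. (uR x, \<xi> x) \<in> R x"
    and vL_in: "\<And>x. (vL x, \<eta> x) \<in> L x" and vR_in: "\<And>x. (vR x, \<eta> x) \<in> R x"
    and w: "(w, \<zeta>L x) \<in> L x" "(w, \<zeta>LR x) \<in> R x"
    and z: "(z, \<zeta>LR x) \<in> L x" "(z, \<zeta>R x) \<in> R x"
  shows "torsion_in c (uL, uR, vL, vR, \<zeta>L, \<zeta>LR, \<zeta>R) x = 0"
proof -
  have Q_mem: "(a + b, \<theta>) \<in> cotangent_product L R y" if "(a, \<theta>) \<in> L y" "(b, \<theta>) \<in> R y"
    for a b \<theta> y
    using that unfolding cotangent_product_def by force
  note add = smooth_field_on_add[OF A open_UNIV]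
  have "blinfun_apply (\<zeta>LR x c) (bracket_in c (\<lambda>x. uL x + uR x) (\<lambda>x. vL x + vR x) x)
      = - dorfman_form_in c (\<lambda>x. uL x + uR x) \<xi> (\<lambda>x. vL x + vR x) \<eta> x ((z + w) c)"
    by (rule dirac_structure_pairing[OF Q c add[OF uL uR] add[OF vL vR] \<xi> \<eta>])
      (intro Q_mem uL_in uR_in vL_in vR_in w z)+
  moreover have "bracket_in c (\<lambda>x. uL x + uR x) (\<lambda>x. vL x + vR x) x
      = bracket_in c uL vL x + bracket_in c uL vR x + bracket_in c uR vL x + bracket_in c uR vR x"
    by (simp add: bracket_in_def drep_add[OF uL uR c] drep_add[OF vL vR c]
        linear_add[OF linear_drep[OF uL c]] linear_add[OF linear_drep[OF uR c]]
        linear_add[OF linear_drep[OF vL c]] linear_add[OF linear_drep[OF vR c]])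
  moreover have "dorfman_form_in c (\<lambda>x. uL x + uR x) \<xi> (\<lambda>x. vL x + vR x) \<eta> x ((z + w) c)
      = dorfman_form_in c uL \<xi> vL \<eta> x (z c) + dorfman_form_in c uL \<xi> vL \<eta> x (w c)
      + dorfman_form_in c uR \<xi> vR \<eta> x (z c) + dorfman_form_in c uR \<xi> vR \<eta> x (w c)"
    by (simp add: dorfman_form_in_def drep_add[OF uL uR c] blinfun.add_left blinfun.add_right
        linear_add[OF linear_drep[OF uL c]] linear_add[OF linear_drep[OF uR c]]
        linear_add[OF linear_drep[OF \<xi> c]] linear_add[OF linear_drep[OF \<eta> c]])
  moreover note
    dirac_structure_pairing[OF L c uL vL \<xi> \<eta> uL_in vL_in w(1)]
    dirac_structure_pairing[OF L c uL vL \<xi> \<eta> uL_in vL_in z(1)]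
    dirac_structure_pairing[OF R c uR vR \<xi> \<eta> uR_in vR_in w(2)]
    dirac_structure_pairing[OF R c uR vR \<xi> \<eta> uR_in vR_in z(2)]
  ultimately show ?thesis
    by (simp add: torsion_in_def blinfun.add_right)
qed

lemma continuous_on_torsion_in:
  fixes A :: "('a::{t2_space,second_countable_topology}, 'e::real_inner) chart set"
  assumes A: "smooth_manifold A" and c: "c \<in> A"
    and uL: "smooth_field_on A UNIV uL" and uR: "smooth_field_on A UNIV uR"
    and vL: "smooth_field_on A UNIV vL" and vR: "smooth_field_on A UNIV vR"
    and \<zeta>L: "smooth_field_on A UNIV \<zeta>L" and \<zeta>LR: "smooth_field_on A UNIV \<zeta>LR"
    and \<zeta>R: "smooth_field_on A UNIV \<zeta>R"
  shows "continuous_on (cmap c ` cdom c)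
    (\<lambda>y. torsion_in c (uL, uR, vL, vR, \<zeta>L, \<zeta>LR, \<zeta>R) (cinv c y))"
proof -
  note bracket = smooth_on_imp_continuous_on[OF smooth_on_bracket_in[OF A c]]
  have form: "continuous_on (cmap c ` cdom c) (\<lambda>y. \<zeta> (cinv c y) c)"
    if "smooth_field_on A UNIV \<zeta>" for \<zeta> :: "'a \<Rightarrow> ('a, 'e) covec"
    by (rule smooth_on_imp_continuous_on[OF smooth_field_onD[OF that c]]) simp
  show ?thesis
    unfolding torsion_in_def case_prod_conv
    by (intro continuous_on_add continuous_on_diff
        bounded_bilinear.continuous_on[OF bounded_bilinear_blinfun_apply]
        form bracket uL uR vL vR \<zeta>L \<zeta>LR \<zeta>R)
qed

text \<open>
  The closure of a Dirac structure under the bracket concerns global sections. Multiplying by a bump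
  function that is \<open>1\<close> near \<open>x\<close> supplies them.
\<close>

lemma torsion_in_zero_of_local_common_forms:
  fixes A :: "('a::{t2_space,second_countable_topology}, 'e::real_inner) chart set"
  assumes L: "dirac_structure A L" and R: "dirac_structure A R"
    and Q: "dirac_structure A (cotangent_product L R)"
    and A: "smooth_manifold A" and c: "c \<in> charts_at A x"
    and u: "smooth_field_on A UNIV uL" "smooth_field_on A UNIV uR"
    and v: "smooth_field_on A UNIV vL" "smooth_field_on A UNIV vR"
    and N: "open N" "x \<in> N"
    and \<xi>: "smooth_field_on A N \<xi>" "\<And>z. z \<in> N \<Longrightarrow> (uL z, \<xi> z) \<in> L z \<and> (uR z, \<xi> z) \<in> R z"
    and \<eta>: "smooth_field_on A N \<eta>" "\<And>z. z \<in> N \<Longrightarrow> (vL z, \<eta> z) \<in> L z \<and> (vR z, \<eta> z) \<in> R z"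
    and w: "(w, \<zeta>L x) \<in> L x" "(w, \<zeta>LR x) \<in> R x"
    and z: "(z, \<zeta>LR x) \<in> L x" "(z, \<zeta>R x) \<in> R x"
  shows "torsion_in c (uL, uR, vL, vR, \<zeta>L, \<zeta>LR, \<zeta>R) x = 0"
proof -
  obtain \<phi> K N' where \<phi>: "smooth_fun_on A UNIV \<phi>" and K: "closed K" "K \<subseteq> N"
    and \<phi>_zero: "\<And>z. z \<notin> K \<Longrightarrow> \<phi> z = 0"
    and N': "open N'" "x \<in> N'" "N' \<subseteq> N" "\<And>z. z \<in> N' \<Longrightarrow> \<phi> z = 1"
    using ex_bump_function[OF A N] by blast
  note cut_field = smooth_field_on_scaleR[OF A open_UNIV \<phi>]
  have \<phi>N: "smooth_fun_on A N \<phi>" using smooth_field_on_subset[OF \<phi>] by simp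
  have cut_form: "smooth_field_on A UNIV (\<lambda>z. \<phi> z *\<^sub>R \<theta> z)" if "smooth_field_on A N \<theta>"
    for \<theta> :: "'a \<Rightarrow> ('a, 'e) covec"
    by (rule smooth_field_on_extend_by_zero[OF A N(1) K
          smooth_field_on_scaleR[OF A N(1) \<phi>N that]]) (simp_all add: \<phi>_zero)
  have cut_in: "(\<phi> z *\<^sub>R a z, \<phi> z *\<^sub>R \<theta> z) \<in> F z"
    if F: "dirac_structure A F" and mem: "\<And>z. z \<in> N \<Longrightarrow> (a z, \<theta> z) \<in> F z"
    for F :: "('a, 'e) family" and a \<theta> z
  proof -
    have "lagrangian_family A F" using F by (simp add: dirac_structure_def)
    note sub = lagrangian_family_subspace[OF this, of z]
    show ?thesis
    proof (cases "z \<in> N")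
      case True
      then show ?thesis using subspace_scale[OF sub mem[OF True], of "\<phi> z"] by simp
    next
      case False
      then have "\<phi> z = 0" using K(2) \<phi>_zero by blast
      then show ?thesis using subspace_0[OF sub] by (simp add: zero_prod_def)
    qed
  qed
  have "torsion_in c (\<lambda>z. \<phi> z *\<^sub>R uL z, \<lambda>z. \<phi> z *\<^sub>R uR z, \<lambda>z. \<phi> z *\<^sub>R vL z, \<lambda>z. \<phi> z *\<^sub>R vR z,
      \<zeta>L, \<zeta>LR, \<zeta>R) x = 0"
  proof (rule torsion_in_zero_of_common_forms[OF L R Q A c cut_field[OF u(1)] cut_field[OF u(2)]
        cut_field[OF v(1)] cut_field[OF v(2)] cut_form[OF \<xi>(1)] cut_form[OF \<eta>(1)]])
    fix z
    show "(\<phi> z *\<^sub>R uL z, \<phi> z *\<^sub>R \<xi> z) \<in> L z" "(\<phi> z *\<^sub>R vL z, \<phi> z *\<^sub>R \<eta> z) \<in> L z"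
      by (intro cut_in[OF L]; simp add: \<xi>(2) \<eta>(2))+
    show "(\<phi> z *\<^sub>R uR z, \<phi> z *\<^sub>R \<xi> z) \<in> R z" "(\<phi> z *\<^sub>R vR z, \<phi> z *\<^sub>R \<eta> z) \<in> R z"
      by (intro cut_in[OF R]; simp add: \<xi>(2) \<eta>(2))+
  qed (fact w z)+
  moreover have "bracket_in c (\<lambda>z. \<phi> z *\<^sub>R a z) (\<lambda>z. \<phi> z *\<^sub>R b z) x = bracket_in c a b x"
    if "smooth_field_on A UNIV a" "smooth_field_on A UNIV b" for a b :: "'a \<Rightarrow> ('a, 'e) tvec"
    by (rule bracket_in_cong[OF A c N'(1,2) _ _ cut_field[OF that(1)] cut_field[OF that(2)]])
      (simp_all add: N'(4))
  ultimately show ?thesis by (simp add: torsion_in_def u v)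
qed

text \<open>
  If the torsion were nonzero at \<open>x\<close>, it would be nonzero on an open set. Shrinking that set
  once for each of the two pairs of vector fields leaves a point near which both have a smooth common form.
\<close>

lemma torsion_in_zero:
  fixes A :: "('a::{t2_space,second_countable_topology}, 'e::real_inner) chart set"
  assumes A: "smooth_manifold A"
    and L: "dirac_structure A L" and R: "dirac_structure A R"
    and Q: "dirac_structure A (cotangent_product L R)"
    and p: "p \<in> torsion_domain A L R" and c: "c \<in> charts_at A x"
  shows "torsion_in c p x = 0"
proof (rule ccontr)
  assume nonzero: "torsion_in c p x \<noteq> 0"
  obtain uL uR vL vR \<zeta>L \<zeta>LR \<zeta>R where p_eq: "p = (uL, uR, vL, vR, \<zeta>L, \<zeta>LR, \<zeta>R)"
    by (cases p)
  have smooth: "smooth_field_on A UNIV uL" "smooth_field_on A UNIV uR"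
      "smooth_field_on A UNIV vL" "smooth_field_on A UNIV vR"
      "smooth_field_on A UNIV \<zeta>L" "smooth_field_on A UNIV \<zeta>LR" "smooth_field_on A UNIV \<zeta>R"
    using p unfolding p_eq torsion_domain_def vector_field_on_def one_form_on_def
      smooth_field_on_def by simp_all
  have u_ex: "\<exists>\<xi>. (uL z, \<xi>) \<in> L z \<and> (uR z, \<xi>) \<in> R z"
    and v_ex: "\<exists>\<xi>. (vL z, \<xi>) \<in> L z \<and> (vR z, \<xi>) \<in> R z"
    and w_ex: "\<exists>w. (w, \<zeta>L z) \<in> L z \<and> (w, \<zeta>LR z) \<in> R z"
    and z_ex: "\<exists>w. (w, \<zeta>LR z) \<in> L z \<and> (w, \<zeta>R z) \<in> R z" for z
    using p unfolding p_eq torsion_domain_def diamond_T_def diamond_coT_def by blast+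
  have LR: "lagrangian_family A L" "smooth_family A L" "lagrangian_family A R" "smooth_family A R"
    using L R by (simp_all add: dirac_structure_def)
  have cA: "c \<in> A" "x \<in> cdom c" using c by (auto simp: charts_at_def)
  note ch = manifold_chart[OF A cA(1)]
  let ?T = "\<lambda>y. torsion_in c p (cinv c y)"
  define V where "V = ?T -` (- {0}) \<inter> cmap c ` cdom c"
  have "open (cmap c ` cdom c)" using ch unfolding is_chart_def by blast
  moreover have "continuous_on (cmap c ` cdom c) ?T"
    unfolding p_eq by (rule continuous_on_torsion_in[OF A cA(1) smooth])
  ultimately have V_open: "open V"
    unfolding V_def by (simp add: continuous_on_open_vimage open_Compl)
  have "cmap c x \<in> V" using nonzero cA(2) by (simp add: V_def cinv_cmap[OF ch])
  then have V_ne: "V \<noteq> {}" by blast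
  have V_sub: "V \<subseteq> cmap c ` cdom c" by (simp add: V_def)
  obtain W1 \<xi> where W1: "open W1" "W1 \<noteq> {}" "W1 \<subseteq> V"
    and \<xi>: "smooth_field_on A (cdom c \<inter> cmap c -` W1) \<xi>"
      "\<forall>z\<in>cdom c \<inter> cmap c -` W1. (uL z, \<xi> z) \<in> L z \<and> (uR z, \<xi> z) \<in> R z"
    by (rule ex_smooth_common_form[OF A cA(1) LR smooth(1,2) u_ex V_open V_ne V_sub])
  obtain W2 \<eta> where W2: "open W2" "W2 \<noteq> {}" "W2 \<subseteq> W1"
    and \<eta>: "smooth_field_on A (cdom c \<inter> cmap c -` W2) \<eta>"
      "\<forall>z\<in>cdom c \<inter> cmap c -` W2. (vL z, \<eta> z) \<in> L z \<and> (vR z, \<eta> z) \<in> R z"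
    by (rule ex_smooth_common_form[OF A cA(1) LR smooth(3,4) v_ex W1(1,2)
          order.trans[OF W1(3) V_sub]])
  obtain y where y: "y \<in> W2" using W2(2) by blast
  then have yV: "y \<in> V" using W2(3) W1(3) by blast
  then have y_img: "y \<in> cmap c ` cdom c" using V_sub by blast
  define N where "N = cdom c \<inter> cmap c -` W2"
  have N: "open N" "cinv c y \<in> N"
    using open_chart_preimage[OF ch W2(1)] y cinv_in_cdom[OF ch y_img] cmap_cinv[OF ch y_img]
    by (auto simp: N_def)
  have N_sub: "N \<subseteq> cdom c \<inter> cmap c -` W1" using W2(3) by (auto simp: N_def)
  have cy: "c \<in> charts_at A (cinv c y)"
    using cA(1) cinv_in_cdom[OF ch y_img] by (simp add: charts_at_def)
  obtain w where w: "(w, \<zeta>L (cinv c y)) \<in> L (cinv c y)" "(w, \<zeta>LR (cinv c y)) \<in> R (cinv c y)"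
    using w_ex by blast
  obtain z where z: "(z, \<zeta>LR (cinv c y)) \<in> L (cinv c y)" "(z, \<zeta>R (cinv c y)) \<in> R (cinv c y)"
    using z_ex by blast
  have "torsion_in c p (cinv c y) = 0"
    unfolding p_eq
  proof (rule torsion_in_zero_of_local_common_forms[OF L R Q A cy smooth(1-4) N
        smooth_field_on_subset[OF \<xi>(1) N_sub] _ \<eta>(1)[folded N_def]])
    fix x assume x: "x \<in> N"
    show "(uL x, \<xi> x) \<in> L x \<and> (uR x, \<xi> x) \<in> R x" using x \<xi>(2) N_sub by blast
    show "(vL x, \<eta> x) \<in> L x \<and> (vR x, \<eta> x) \<in> R x" using x \<eta>(2) unfolding N_def by blast
  qed (fact w z)+
  then show False using yV by (simp add: V_def)
qed

theorem theoremB: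
  fixes A :: "('a::{t2_space,second_countable_topology}, 'e::real_inner) chart set"
    and L R :: "('a, 'e) family"
  assumes "smooth_manifold A"
    and "dirac_structure A L"
    and "dirac_structure A R"
    and "concur A L R"
  shows "dirac_pair A L R"
proof -
  have "dirac_structure A (cotangent_product L R)"
    using assms(4) unfolding concur_def by blast
  then have "torsion A p x = 0" if "p \<in> torsion_domain A L R" for p x
    using torsion_eq_torsion_in[OF assms(1), of x p] torsion_in_zero[OF assms(1-3) _ that] by auto
  then show ?thesis using assms(2,3) by (simp add: dirac_pair_def)
qed

end
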